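(* (1) Let $G$ be one of $D_{2m}$ ($m\ge3$), $T_{4m}$, $U_{(n,m)}$ ($n\ge2$), $SD_{8m}$ with $m\ge3$ odd. Then $\Gamma_G$ is integral iff $m=2a^2+1$ for some integer $a\ge1$. (2) Let $G$ be $D_{2m}$ or $U_{(n,m)}$ ($n\ge 2$) with $m$ even and $m/2$ odd, $m\ge 6$. Then $\Gamma_G$ is integral iff $m=a^2+2$ for some integer $a\ge2$. (3) Let $m\ge4$ with $m$ and $m/2$ even. Then $\Gamma_{D_{2m}}$ is integral iff $4m-7$ is a perfect square. (4) Let $m\ge2$ be even. Then $\Gamma_{T_{4m}}$ is integral iff $8m-7$ is a perfect square, and $\Gamma_{SD_{8m}}$ is integral iff $16m-7$ is a perfect square. (5) For even $m\ge2$, $\Gamma_{V_{8m}}$ is integral iff $8m-7$ is a perfect square; for odd $m\ge3$, $\Gamma_{V_{8m}}$ is integral iff $16m-7$ is a perfect square.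
   Context: Groups: $D_{2m}=\langle x,y\mid x^m=y^2=1,\ yxy^{-1}=x^{-1}\rangle$; $T_{4m}=\langle x,y\mid x^{2m}=1,\ x^m=y^2,\ y^{-1}xy=x^{-1}\rangle$; $SD_{8m}=\langle x,y\mid x^{4m}=y^2=1,\ yxy=x^{2m-1}\rangle$; $U_{(n,m)}=\langle x,y\mid x^{2n}=y^m=1,\ x^{-1}yx=y^{-1}\rangle$; $V_{8m}=\langle x,y\mid x^{2m}=y^4=1,\ yx=x^{-1}y^{-1},\ y^{-1}x=x^{-1}y\rangle$. For a finite non-abelian group $G$ with center $Z(G)$, the NCCC-graph $\Gamma_G$ has vertex set $\{x^G: x\in G\setminus Z(G)\}$ ($x^G$ the conjugacy class of $x$), distinct vertices $x^G,y^G$ adjacent iff $x'y'\neq y'x'$ for all $x'\in x^G,y'\in y^G$. A graph is integral if all eigenvalues of its adjacency matrix are integers. *)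

theory Defs
  imports "HOL-Algebra.Algebra" Complex_Main
begin

definition grp_center :: "('a, 'b) monoid_scheme \<Rightarrow> 'a set" where
  "grp_center G = {z \<in> carrier G. \<forall>g \<in> carrier G. z \<otimes>\<^bsub>G\<^esub> g = g \<otimes>\<^bsub>G\<^esub> z}"

definition conj_class :: "('a, 'b) monoid_scheme \<Rightarrow> 'a \<Rightarrow> 'a set" where
  "conj_class G x = {g \<otimes>\<^bsub>G\<^esub> x \<otimes>\<^bsub>G\<^esub> inv\<^bsub>G\<^esub> g | g. g \<in> carrier G}"

definition nccc_vertices :: "('a, 'b) monoid_scheme \<Rightarrow> 'a set set" where
  "nccc_vertices G = conj_class G ` (carrier G - grp_center G)"

definition nccc_adj :: "('a, 'b) monoid_scheme \<Rightarrow> 'a set \<Rightarrow> 'a set \<Rightarrow> bool" where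
  "nccc_adj G A B \<longleftrightarrow> A \<noteq> B \<and>
     (\<forall>a \<in> A. \<forall>b \<in> B. a \<otimes>\<^bsub>G\<^esub> b \<noteq> b \<otimes>\<^bsub>G\<^esub> a)"

definition adj_eigenvalue :: "'v set \<Rightarrow> ('v \<Rightarrow> 'v \<Rightarrow> bool) \<Rightarrow> complex \<Rightarrow> bool" where
  "adj_eigenvalue V adj lam \<longleftrightarrow>
     (\<exists>v :: 'v \<Rightarrow> complex. (\<exists>u \<in> V. v u \<noteq> 0) \<and>
        (\<forall>u \<in> V. (\<Sum>w \<in> {w \<in> V. adj u w}. v w) = lam * v u))"

definition integral_graph :: "'v set \<Rightarrow> ('v \<Rightarrow> 'v \<Rightarrow> bool) \<Rightarrow> bool" where
  "integral_graph V adj \<longleftrightarrow> (\<forall>lam. adj_eigenvalue V adj lam \<longrightarrow> lam \<in> \<int>)"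

definition nccc_integral :: "('a, 'b) monoid_scheme \<Rightarrow> bool" where
  "nccc_integral G \<longleftrightarrow> integral_graph (nccc_vertices G) (nccc_adj G)"

text \<open>In each model the pair (i, j) stands for the normal form x^i y^j, with
  x = (1,0) and y = (0,1).\<close>

text \<open>D_{2m} = <x,y | x^m = y^2 = 1, y x y^-1 = x^-1>, order 2m.\<close>
definition dihedral :: "nat \<Rightarrow> (int \<times> int) monoid" where
  "dihedral m = \<lparr> carrier = {0..<int m} \<times> {0..<2},
     monoid.mult = (\<lambda>(i1, j1) (i2, j2).
        ((i1 + (if j1 = 0 then i2 else - i2)) mod int m, (j1 + j2) mod 2)),
     one = (0, 0) \<rparr>"

text \<open>T_{4m} = <x,y | x^{2m} = 1, x^m = y^2, y^-1 x y = x^-1>, order 4m.\<close>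
definition dicyclic :: "nat \<Rightarrow> (int \<times> int) monoid" where
  "dicyclic m = \<lparr> carrier = {0..<2 * int m} \<times> {0..<2},
     monoid.mult = (\<lambda>(i1, j1) (i2, j2).
        ((i1 + (if j1 = 0 then i2 else - i2) + int m * j1 * j2) mod (2 * int m),
         (j1 + j2) mod 2)),
     one = (0, 0) \<rparr>"

text \<open>SD_{8m} = <x,y | x^{4m} = y^2 = 1, y x y = x^{2m-1}>, order 8m.\<close>
definition semidihedral :: "nat \<Rightarrow> (int \<times> int) monoid" where
  "semidihedral m = \<lparr> carrier = {0..<4 * int m} \<times> {0..<2},
     monoid.mult = (\<lambda>(i1, j1) (i2, j2).
        ((i1 + (if j1 = 0 then i2 else (2 * int m - 1) * i2)) mod (4 * int m),
         (j1 + j2) mod 2)),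
     one = (0, 0) \<rparr>"

text \<open>U_{(n,m)} = <x,y | x^{2n} = y^m = 1, x^-1 y x = y^-1>, order 2nm.\<close>
definition U_group :: "nat \<Rightarrow> nat \<Rightarrow> (int \<times> int) monoid" where
  "U_group n m = \<lparr> carrier = {0..<2 * int n} \<times> {0..<int m},
     monoid.mult = (\<lambda>(i1, j1) (i2, j2).
        ((i1 + i2) mod (2 * int n), ((if even i2 then j1 else - j1) + j2) mod int m)),
     one = (0, 0) \<rparr>"

text \<open>V_{8m} = <x,y | x^{2m} = y^4 = 1, y x = x^-1 y^-1, y^-1 x = x^-1 y>, order 8m.
  In it y^2 is central and y^j x^k = x^((-1)^j k) y^(j + 2k (j mod 2)).\<close>
definition V_group :: "nat \<Rightarrow> (int \<times> int) monoid" where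
  "V_group m = \<lparr> carrier = {0..<2 * int m} \<times> {0..<4},
     monoid.mult = (\<lambda>(i1, j1) (i2, j2).
        ((i1 + (if even j1 then i2 else - i2)) mod (2 * int m),
         (j1 + j2 + 2 * i2 * (j1 mod 2)) mod 4)),
     one = (0, 0) \<rparr>"

end

theory Submission
  imports Defs
begin

text \<open>
  Each of the groups has an abelian subgroup A of index two. With Z the centre, a = |A| and
  z = |Z|, every class inside A - Z has two elements and every class outside A has a / z elements,
  so there are (a - z) / 2 classes of the first kind and z of the second kind. An element of A - Z
  commutes only with elements of A, and two elements outside A commute only if they differ by a
  factor in Z. Hence the graph is complete multipartite: the classes inside A - Z form one part,
  and the classes outside A form either one part, or two parts of equal size, told apart by the
  parity of the exponent of x. The nonzero eigenvalues of the complete bipartite graph with parts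
  p, q are the square roots of p q. The eigenvalues of the complete tripartite graph with parts
  p, p, q are the roots of t^2 - p t - 2 p q and possibly 0 and -p, so they are integral iff the
  discriminant p^2 + 8 p q is a square.
\<close>

section \<open>Complete multipartite graphs\<close>

text \<open>Whether the classes outside A form one part or two depends on how far an exponent can be
  shifted by conjugation and by central factors. If A = <x> and y x y^-1 = x^r, conjugation by x^k
  turns x^i y into x^(i + (1 - r) k) y, and a central x^e adds e. For each family an explicit pair
  e, k realises either the shift 1, which links everything outside A, or the shift 2, while a parity
  argument excludes odd shifts. The criteria come from the ratio a / z alone. In the bipartite case
  the product of the part sizes is z^2 (a/z - 1) / 2; in the tripartite case the two equal parts
  have size p = z / 2 and the discriminant is p^2 (8 a/z - 7). Removing square factors leaves (a/z -
  1) / 2 and 8 a/z - 7, and inserting a/z for each group gives all the numbers of the theorem. The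
  cyclic subgroup serves for D, T and SD simultaneously; for U and V a subgroup with two generators
  is used, so these only share the abstract part.\<close>

lemma real_square_in_Ints_imp_square:
  fixes x :: real and d :: nat
  assumes "x \<in> \<int>" "x\<^sup>2 = real d"
  shows "\<exists>k::nat. d = k\<^sup>2"
proof -
  obtain j where j: "x = of_int j" using assms(1) by (auto elim: Ints_cases)
  have "real d = real ((nat \<bar>j\<bar>)\<^sup>2)" using assms(2) by (simp add: j)
  then show ?thesis by (metis of_nat_eq_iff)
qed

lemma complex_of_real_in_Ints_iff: "complex_of_real x \<in> \<int> \<longleftrightarrow> x \<in> \<int>"
proof
  assume "complex_of_real x \<in> \<int>"
  then obtain j where "complex_of_real x = of_int j" by (auto elim: Ints_cases)
  then have "x = of_int j" by (metis of_real_eq_iff of_real_of_int_eq)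
  then show "x \<in> \<int>" by simp
qed (auto elim!: Ints_cases)

text \<open>The eigenvalue equation at a vertex involves only the sum of \<open>v\<close> over the
  opposite part. Adding the equations over each part leaves a linear system in the two sums, and a
  nonzero \<open>lam\<close> cannot come from a vector with both sums zero.\<close>

lemma integral_complete_bipartite_iff:
  assumes fin: "finite P" "finite Q" and ne: "P \<noteq> {}" "Q \<noteq> {}" and dis: "P \<inter> Q = {}"
    and V: "V = P \<union> Q"
    and adj: "\<And>u w. u \<in> V \<Longrightarrow> w \<in> V \<Longrightarrow> adj u w \<longleftrightarrow> (u \<in> P) \<noteq> (w \<in> P)"
  shows "integral_graph V adj \<longleftrightarrow> (\<exists>k::nat. card P * card Q = k\<^sup>2)"
proof -
  define p where "p = card P"
  define q where "q = card Q"
  have pq0: "p > 0" "q > 0" using fin ne by (auto simp: p_def q_def card_gt_0_iff)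
  have nP: "{w \<in> V. adj u w} = Q" if "u \<in> P" for u using that adj dis by (auto simp: V)
  have nQ: "{w \<in> V. adj u w} = P" if "u \<in> Q" for u using that adj dis by (auto simp: V)
  have eig: "adj_eigenvalue V adj lam \<longleftrightarrow> (\<exists>v. (\<exists>u\<in>V. v u \<noteq> 0) \<and>
      (\<forall>u\<in>P. sum v Q = lam * v u) \<and> (\<forall>u\<in>Q. sum v P = lam * v u))" for lam
    unfolding adj_eigenvalue_def using nP nQ by (simp add: V ball_Un)
  show ?thesis
  proof
    assume int: "integral_graph V adj"
    define lam where "lam = sqrt (real (p * q))"
    have lam2: "lam * lam = p * q" unfolding lam_def by simp
    \<comment> \<open>An eigenvector constant on both parts: the equation on \<open>P\<close> then
      holds identically and the one on \<open>Q\<close> is \<open>lam * lam = p * q\<close>.\<close>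
    define v where "v = (\<lambda>u. if u \<in> P then of_nat q else complex_of_real lam)"
    have vQ: "v u = of_real lam" if "u \<in> Q" for u using that dis by (auto simp: v_def)
    then have "sum v Q = of_nat q * of_real lam" by (simp add: q_def)
    moreover have "sum v P = of_nat p * of_nat q" by (simp add: v_def p_def)
    moreover have "of_real lam * of_real lam = (of_nat p * of_nat q :: complex)"
      by (metis lam2 of_real_mult of_real_of_nat_eq of_nat_mult)
    ultimately have "adj_eigenvalue V adj (of_real lam)"
      unfolding eig using pq0 ne vQ by (intro exI[of _ v]) (auto simp: v_def V)
    then have "lam \<in> \<int>" using int complex_of_real_in_Ints_iff unfolding integral_graph_def by blast
    moreover have "lam\<^sup>2 = real (p * q)" by (simp add: lam2 power2_eq_square)
    ultimately show "\<exists>k::nat. card P * card Q = k\<^sup>2"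
      using real_square_in_Ints_imp_square unfolding p_def q_def by blast
  next
    assume "\<exists>k::nat. card P * card Q = k\<^sup>2"
    then obtain k :: nat where k: "p * q = k\<^sup>2" unfolding p_def q_def by auto
    show "integral_graph V adj" unfolding integral_graph_def
    proof (intro allI impI)
      fix lam assume "adj_eigenvalue V adj lam"
      then obtain v where v: "\<exists>u\<in>V. v u \<noteq> 0" "\<And>u. u \<in> P \<Longrightarrow> sum v Q = lam * v u"
        "\<And>u. u \<in> Q \<Longrightarrow> sum v P = lam * v u" unfolding eig by blast
      have s1: "of_nat p * sum v Q = lam * sum v P"
        using sum.cong[OF refl v(2), of P] by (simp add: p_def sum_distrib_left)
      have s2: "of_nat q * sum v P = lam * sum v Q"
        using sum.cong[OF refl v(3), of Q] by (simp add: q_def sum_distrib_left)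
      show "lam \<in> \<int>"
      proof (cases "lam = 0")
        case False
        \<comment> \<open>If this sum vanished, \<open>s2\<close> would make the other one vanish
          too, and \<open>lam * v u = 0\<close> would hold at every vertex.\<close>
        have ns: "sum v P \<noteq> 0"
          using v False s2 s1 pq0 unfolding V by fastforce
        have "lam * (lam * sum v P) = (of_nat p * of_nat q) * sum v P"
          using s1 s2 by (metis mult.assoc mult.left_commute)
        then have "lam * lam = of_nat (p * q)" using ns by (simp add: mult.assoc[symmetric])
        then have "lam\<^sup>2 = (of_nat k)\<^sup>2" by (simp add: k power2_eq_square)
        then have "lam = of_nat k \<or> lam = - of_nat k" by (simp add: power2_eq_iff)
        then show ?thesis by auto
      qed simp
    qed
  qed
qed

text \<open>Equal sizes of \<open>P\<close> and \<open>Q\<close> let the difference of their sums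
  split off with eigenvalue \<open>-p\<close>; the part symmetric in \<open>P\<close> and
  \<open>Q\<close> leaves a quadratic. In \<open>adj\<close>, membership in \<open>P\<close> and in
  \<open>Q\<close> already determines the part of a vertex.\<close>

lemma integral_complete_tripartite_iff:
  assumes fin: "finite P" "finite Q" "finite R" and ne: "P \<noteq> {}" "R \<noteq> {}"
    and dis: "P \<inter> Q = {}" "P \<inter> R = {}" "Q \<inter> R = {}"
    and card: "card P = p" "card Q = p" "card R = q"
    and V: "V = P \<union> Q \<union> R"
    and adj: "\<And>u w. u \<in> V \<Longrightarrow> w \<in> V \<Longrightarrow>
      adj u w \<longleftrightarrow> (u \<in> P) \<noteq> (w \<in> P) \<or> (u \<in> Q) \<noteq> (w \<in> Q)"
  shows "integral_graph V adj \<longleftrightarrow> (\<exists>k::nat. p\<^sup>2 + 8 * p * q = k\<^sup>2)"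
proof -
  have pq0: "p > 0" "q > 0" using fin ne card by (auto simp: card_gt_0_iff)
  have nP: "{w \<in> V. adj u w} = Q \<union> R" if "u \<in> P" for u using that adj dis by (auto simp: V)
  have nQ: "{w \<in> V. adj u w} = P \<union> R" if "u \<in> Q" for u using that adj dis by (auto simp: V)
  have nR: "{w \<in> V. adj u w} = P \<union> Q" if "u \<in> R" for u using that adj dis by (auto simp: V)
  have sums: "sum v (Q \<union> R) = sum v Q + sum v R" "sum v (P \<union> R) = sum v P + sum v R"
    "sum v (P \<union> Q) = sum v P + sum v Q" for v :: "_ \<Rightarrow> complex"
    using fin dis by (auto intro: sum.union_disjoint)
  have eig: "adj_eigenvalue V adj lam \<longleftrightarrow> (\<exists>v. (\<exists>u\<in>V. v u \<noteq> 0) \<and>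
      (\<forall>u\<in>P. sum v Q + sum v R = lam * v u) \<and> (\<forall>u\<in>Q. sum v P + sum v R = lam * v u) \<and>
      (\<forall>u\<in>R. sum v P + sum v Q = lam * v u))" for lam
    unfolding adj_eigenvalue_def using nP nQ nR by (simp add: V ball_Un sums)
  show ?thesis
  proof
    assume int: "integral_graph V adj"
    define s where "s = sqrt (real (p\<^sup>2 + 8 * p * q))"
    have s2: "s\<^sup>2 = real (p\<^sup>2 + 8 * p * q)" unfolding s_def by simp
    have "s \<ge> 0" by (simp add: s_def)
    define lam where "lam = (real p + s) / 2"
    have lam0: "lam > 0" using pq0 \<open>s \<ge> 0\<close> by (simp add: lam_def)
    have lam2: "lam * lam = p * lam + 2 * p * q"
      using s2 by (simp add: lam_def power2_eq_square field_simps)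
    have clam2: "of_real lam * of_real lam = (of_nat p * of_real lam + 2 * of_nat p * of_nat q :: complex)"
      using arg_cong[OF lam2, of complex_of_real] by simp
    \<comment> \<open>The value on \<open>R\<close> is chosen so that the equation there holds
      identically; on \<open>P\<close> and on \<open>Q\<close> the equation becomes the quadratic
      \<open>lam2\<close>.\<close>
    define v where "v = (\<lambda>u. if u \<in> R then 2 * of_nat p else complex_of_real lam)"
    have vP: "v u = of_real lam" if "u \<in> P" for u using that dis by (auto simp: v_def)
    have vQ: "v u = of_real lam" if "u \<in> Q" for u using that dis by (auto simp: v_def)
    have vR: "v u = 2 * of_nat p" if "u \<in> R" for u using that dis by (auto simp: v_def)
    have "sum v P = of_nat p * of_real lam" "sum v Q = of_nat p * of_real lam"
      "sum v R = of_nat q * (2 * of_nat p)"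
      using vP vQ vR by (simp_all add: card)
    then have "adj_eigenvalue V adj (of_real lam)"
      unfolding eig using pq0 ne lam0 clam2 vP vQ vR
      by (intro exI[of _ v]) (auto simp: V algebra_simps)
    then have "lam \<in> \<int>" using int complex_of_real_in_Ints_iff unfolding integral_graph_def by blast
    then have "2 * lam - real p \<in> \<int>" by simp
    moreover have "2 * lam - real p = s" by (simp add: lam_def field_simps)
    ultimately have "s \<in> \<int>" by simp
    then show "\<exists>k::nat. p\<^sup>2 + 8 * p * q = k\<^sup>2"
      using real_square_in_Ints_imp_square s2 by blast
  next
    assume "\<exists>k::nat. p\<^sup>2 + 8 * p * q = k\<^sup>2"
    then obtain k :: nat where k: "p\<^sup>2 + 8 * p * q = k\<^sup>2" by auto
    \<comment> \<open>The roots are (p + k) / 2 and (p - k) / 2, so they are integers only because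
      \<open>k\<close> and \<open>p\<close> have the same parity.\<close>
    have "even (k\<^sup>2) \<longleftrightarrow> even (p\<^sup>2)" unfolding k[symmetric] by simp
    then have par: "even (int k) \<longleftrightarrow> even (int p)" by simp
    show "integral_graph V adj" unfolding integral_graph_def
    proof (intro allI impI)
      fix lam assume "adj_eigenvalue V adj lam"
      then obtain v where v: "\<exists>u\<in>V. v u \<noteq> 0"
        "\<And>u. u \<in> P \<Longrightarrow> sum v Q + sum v R = lam * v u"
        "\<And>u. u \<in> Q \<Longrightarrow> sum v P + sum v R = lam * v u"
        "\<And>u. u \<in> R \<Longrightarrow> sum v P + sum v Q = lam * v u" unfolding eig by blast
      have s1: "of_nat p * (sum v Q + sum v R) = lam * sum v P"
        using sum.cong[OF refl v(2), of P] by (simp add: card sum_distrib_left)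
      have s2: "of_nat p * (sum v P + sum v R) = lam * sum v Q"
        using sum.cong[OF refl v(3), of Q] by (simp add: card sum_distrib_left)
      have s3: "of_nat q * (sum v P + sum v Q) = lam * sum v R"
        using sum.cong[OF refl v(4), of R] by (simp add: card sum_distrib_left)
      show "lam \<in> \<int>"
      proof (cases "lam = 0 \<or> lam = - of_nat p")
        case False
        have "lam * sum v P - lam * sum v Q = of_nat p * (sum v Q + sum v R) - of_nat p * (sum v P + sum v R)"
          by (simp only: s1 s2)
        \<comment> \<open>Subtracting the two summed equations isolates the antisymmetric part,
          which must vanish once the eigenvalue \<open>-p\<close> is set aside.\<close>
        then have "(lam + of_nat p) * (sum v P - sum v Q) = 0" by (simp add: algebra_simps)
        moreover have "lam + of_nat p \<noteq> 0" using False by (simp add: add_eq_0_iff2)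
        ultimately have PQ: "sum v Q = sum v P" by simp
        have ns: "sum v P \<noteq> 0"
        proof
          assume 0: "sum v P = 0"
          then have "sum v R = 0" using s3 PQ False by simp
          then show False using v False 0 PQ unfolding V by fastforce
        qed
        have "lam * (lam * sum v P) = of_nat p * lam * sum v P + of_nat p * (lam * sum v R)"
          unfolding s1[symmetric] PQ by (simp add: algebra_simps)
        also have "\<dots> = (of_nat p * lam + 2 * of_nat p * of_nat q) * sum v P"
          unfolding s3[symmetric] PQ by (simp add: algebra_simps)
        finally have lam2: "lam * lam = of_nat p * lam + 2 * of_nat p * of_nat q"
          using ns by (simp add: mult.assoc[symmetric])
        have "(2 * lam - of_nat p)\<^sup>2 = of_nat (p\<^sup>2 + 8 * p * q)"
          using arg_cong[OF lam2, of "\<lambda>x. 4 * x"] by (simp add: power2_eq_square algebra_simps)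
        then have "(2 * lam - of_nat p)\<^sup>2 = (of_nat k)\<^sup>2" by (simp add: k)
        then have "2 * lam - of_nat p = of_int (int k) \<or> 2 * lam - of_nat p = of_int (- int k)"
          by (simp add: power2_eq_iff)
        then obtain j where j: "2 * lam - of_nat p = of_int j" "even j \<longleftrightarrow> even (int p)"
          using par by (metis dvd_minus_iff)
        then have "even (j + int p)" by simp
        then obtain i where i: "j + int p = 2 * i" by (rule evenE)
        have "2 * lam = of_int (j + int p)" using j(1) by (simp add: algebra_simps)
        then have "lam = of_int i" unfolding i by simp
        then show ?thesis by simp
      qed auto
    qed
  qed
qed

section \<open>Groups with an abelian subgroup of index two\<close>

text \<open>Index two is expressed by \<open>mult_mem_A_iff\<close>: membership in \<open>A\<close>
  behaves like a homomorphism to the group of order two. \<open>A_not_central\<close> makes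
  \<open>A\<close> proper and \<open>G\<close> non-abelian at once, as \<open>A = carrier G\<close>
  would be abelian and hence central.\<close>

locale abelian_index_two = group G for G :: "('a, 'b) monoid_scheme" (structure) +
  fixes A :: "'a set"
  assumes finite_carrier: "finite (carrier G)"
    and A_sub: "A \<subseteq> carrier G"
    and mult_mem_A_iff:
      "\<lbrakk>x \<in> carrier G; y \<in> carrier G\<rbrakk> \<Longrightarrow> x \<otimes> y \<in> A \<longleftrightarrow> (x \<in> A \<longleftrightarrow> y \<in> A)"
    and A_comm: "\<lbrakk>x \<in> A; y \<in> A\<rbrakk> \<Longrightarrow> x \<otimes> y = y \<otimes> x"
    and A_not_central: "\<not> A \<subseteq> grp_center G"
begin

abbreviation "Z \<equiv> grp_center G"
abbreviation "outside \<equiv> carrier G - A"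

text \<open>Complements \<open>m_assoc\<close>: once products are nested to the right, these rules
  cancel an element against its inverse in the middle of a word.\<close>

lemma mult_inv_cancel_left [simp]:
  assumes "x \<in> carrier G" "y \<in> carrier G"
  shows "x \<otimes> (inv x \<otimes> y) = y" "inv x \<otimes> (x \<otimes> y) = y"
  using assms by (simp_all add: m_assoc[symmetric])

lemma A_carrier: "x \<in> A \<Longrightarrow> x \<in> carrier G"
  using A_sub by auto

lemma one_mem_A: "\<one> \<in> A"
  using mult_mem_A_iff[of \<one> \<one>] by simp

lemma inv_mem_A_iff: "x \<in> carrier G \<Longrightarrow> inv x \<in> A \<longleftrightarrow> x \<in> A"
  using mult_mem_A_iff[of x "inv x"] one_mem_A by simp

lemma conj_mem_A_iff: "\<lbrakk>g \<in> carrier G; x \<in> carrier G\<rbrakk> \<Longrightarrow> g \<otimes> x \<otimes> inv g \<in> A \<longleftrightarrow> x \<in> A"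
  by (auto simp: mult_mem_A_iff inv_mem_A_iff)

lemma finite_A: "finite A"
  using A_sub finite_carrier finite_subset by blast

lemma outside_eq_mult:
  assumes "g \<in> outside" "h \<in> outside"
  obtains b where "b \<in> A" "h = b \<otimes> g"
proof
  show "h \<otimes> inv g \<in> A" using assms by (simp add: mult_mem_A_iff inv_mem_A_iff)
  show "h = h \<otimes> inv g \<otimes> g" using assms by (simp add: m_assoc)
qed

text \<open>Every element outside \<open>A\<close> is \<open>b \<otimes> g\<close> with
  \<open>b\<close> in \<open>A\<close>, and \<open>a\<close> commutes with both factors. Thus the
  centraliser of \<open>g\<close> in \<open>A\<close> is exactly the centre, which drives all class
  sizes and all adjacencies.\<close>

lemma commute_outside_imp_central:
  assumes a: "a \<in> A" and g: "g \<in> outside" and ag: "a \<otimes> g = g \<otimes> a"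
  shows "a \<in> Z"
proof -
  have "a \<otimes> h = h \<otimes> a" if h: "h \<in> carrier G" for h
  proof (cases "h \<in> A")
    case False
    then obtain b where b: "b \<in> A" "h = b \<otimes> g" using outside_eq_mult g h by blast
    have "a \<otimes> (b \<otimes> g) = b \<otimes> (a \<otimes> g)"
      using a b g A_carrier A_comm[OF a b(1)] by (simp add: m_assoc[symmetric])
    then show ?thesis using a b g A_carrier by (simp add: ag m_assoc)
  qed (use a A_comm in blast)
  then show ?thesis using a A_carrier by (auto simp: grp_center_def)
qed

lemma central_commute: "\<lbrakk>z \<in> Z; g \<in> carrier G\<rbrakk> \<Longrightarrow> z \<otimes> g = g \<otimes> z"
  by (simp add: grp_center_def)

text \<open>A central element outside \<open>A\<close> would commute with all of \<open>A\<close>,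
  and the previous criterion would make \<open>A\<close> central.\<close>

lemma center_subset: "Z \<subseteq> A"
proof
  fix z assume z: "z \<in> Z"
  show "z \<in> A"
  proof (rule ccontr)
    assume "z \<notin> A"
    then have "z \<in> outside" using z by (auto simp: grp_center_def)
    then have "A \<subseteq> Z" using commute_outside_imp_central central_commute[OF z] A_carrier by force
    then show False using A_not_central by simp
  qed
qed

lemma outside_nonempty: "outside \<noteq> {}"
  using A_not_central A_comm A_carrier by (force simp: grp_center_def)

section \<open>Sizes and numbers of conjugacy classes\<close>

lemma self_mem_conj_class: "x \<in> carrier G \<Longrightarrow> x \<in> conj_class G x"
  unfolding conj_class_def by (rule CollectI, rule exI[of _ \<one>]) simp

lemma conj_class_eqI:
  assumes x: "x \<in> carrier G" and y: "y \<in> conj_class G x"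
  shows "conj_class G y = conj_class G x"
proof -
  obtain g where g: "g \<in> carrier G" "y = g \<otimes> x \<otimes> inv g" using y unfolding conj_class_def by auto
  have 1: "h \<otimes> y \<otimes> inv h = (h \<otimes> g) \<otimes> x \<otimes> inv (h \<otimes> g)" if "h \<in> carrier G" for h
    using that g x by (simp add: inv_mult_group m_assoc)
  have 2: "h \<otimes> x \<otimes> inv h = (h \<otimes> inv g) \<otimes> y \<otimes> inv (h \<otimes> inv g)" if "h \<in> carrier G" for h
    using that g x by (simp add: inv_mult_group m_assoc)
  have "conj_class G y \<subseteq> conj_class G x"
    unfolding conj_class_def using 1 m_closed[OF _ g(1)] by blast
  moreover have "conj_class G x \<subseteq> conj_class G y"
    unfolding conj_class_def using 2 m_closed[OF _ inv_closed[OF g(1)]] by blast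
  ultimately show ?thesis by blast
qed

lemma conj_class_disjoint:
  assumes "x \<in> carrier G" "y \<in> carrier G" "conj_class G x \<noteq> conj_class G y"
  shows "conj_class G x \<inter> conj_class G y = {}"
  using assms conj_class_eqI by blast

text \<open>Classes partition a conjugation-closed set. The product form avoids dividing by the
  common class size.\<close>

lemma card_conj_classes:
  assumes S: "S \<subseteq> carrier G" "\<And>x. x \<in> S \<Longrightarrow> conj_class G x \<subseteq> S"
    and k: "\<And>x. x \<in> S \<Longrightarrow> card (conj_class G x) = k"
  shows "k * card (conj_class G ` S) = card S"
proof -
  have U: "\<Union> (conj_class G ` S) = S" using S self_mem_conj_class by blast
  have fS: "finite S" using S(1) finite_carrier finite_subset by blast
  have "k * card (conj_class G ` S) = card (\<Union> (conj_class G ` S))"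
  proof (rule card_partition)
    show "c \<inter> c' = {}" if "c \<in> conj_class G ` S" "c' \<in> conj_class G ` S" "c \<noteq> c'" for c c'
      using that S(1) conj_class_disjoint by blast
  qed (use U fS k in auto)
  then show ?thesis by (simp only: U)
qed

text \<open>Elements of \<open>A\<close> fix \<open>a\<close>, and \<open>b \<otimes> g\<close> acts
  on it as \<open>g\<close> does, because \<open>g \<otimes> a \<otimes> inv g\<close> lies in
  \<open>A\<close> again and commutes with \<open>b\<close>.\<close>

lemma conj_class_inside:
  assumes a: "a \<in> A" and g: "g \<in> outside"
  shows "conj_class G a = {a, g \<otimes> a \<otimes> inv g}"
proof -
  have "h \<otimes> a \<otimes> inv h \<in> {a, g \<otimes> a \<otimes> inv g}" if h: "h \<in> carrier G" for h
  proof (cases "h \<in> A")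
    case True
    then have "h \<otimes> a = a \<otimes> h" using a A_comm by blast
    then show ?thesis using a h A_carrier by (simp add: m_assoc)
  next
    case False
    then obtain b where b: "b \<in> A" "h = b \<otimes> g" using outside_eq_mult g h by blast
    have "h \<otimes> a \<otimes> inv h = b \<otimes> (g \<otimes> a \<otimes> inv g) \<otimes> inv b"
      using a b g A_carrier by (simp add: m_assoc inv_mult_group)
    also have "\<dots> = (g \<otimes> a \<otimes> inv g) \<otimes> b \<otimes> inv b"
      using A_comm[OF b(1), of "g \<otimes> a \<otimes> inv g"] conj_mem_A_iff g a A_carrier by simp
    finally show ?thesis using a b g A_carrier by (simp add: m_assoc)
  qed
  moreover have "a \<in> conj_class G a" using self_mem_conj_class a A_carrier by blast
  ultimately show ?thesis using g by (auto simp: conj_class_def)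
qed

lemma card_conj_class_inside:
  assumes "a \<in> A - Z"
  shows "card (conj_class G a) = 2"
proof -
  obtain g where g: "g \<in> outside" using outside_nonempty by blast
  have "a \<noteq> g \<otimes> a \<otimes> inv g"
  proof
    assume "a = g \<otimes> a \<otimes> inv g"
    then have "a \<otimes> g = (g \<otimes> a \<otimes> inv g) \<otimes> g" by simp
    then have "a \<otimes> g = g \<otimes> a" using g assms A_carrier by (simp add: m_assoc)
    then show False using commute_outside_imp_central g assms by blast
  qed
  then show ?thesis using conj_class_inside g assms by simp
qed

lemma conj_inside_noncentral:
  assumes "a \<in> A - Z"
  shows "conj_class G a \<subseteq> A - Z"
proof
  fix y assume y: "y \<in> conj_class G a"
  have yA: "y \<in> A" using y assms conj_mem_A_iff A_carrier by (auto simp: conj_class_def)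
  have "y \<notin> Z"
  proof
    assume "y \<in> Z"
    obtain g where g: "g \<in> outside" using outside_nonempty by blast
    have "g \<otimes> y \<otimes> inv g = y"
      using central_commute[OF \<open>y \<in> Z\<close>, of g, symmetric] g yA A_carrier by (simp add: m_assoc)
    then have "conj_class G y = {y}" using conj_class_inside[OF yA g] by simp
    then show False
      using conj_class_eqI[OF _ y] assms A_carrier card_conj_class_inside[OF assms]
      by (force dest: arg_cong[of _ _ card])
  qed
  with yA show "y \<in> A - Z" by simp
qed

lemma conj_outside: "g \<in> outside \<Longrightarrow> conj_class G g \<subseteq> outside"
  using conj_mem_A_iff by (auto simp: conj_class_def)

lemma card_inside_classes: "2 * card (conj_class G ` (A - Z)) = card A - card Z"
proof -
  have "2 * card (conj_class G ` (A - Z)) = card (A - Z)"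
    by (rule card_conj_classes) (use A_sub conj_inside_noncentral card_conj_class_inside in auto)
  then show ?thesis using center_subset finite_A by (simp add: card_Diff_subset finite_subset)
qed

text \<open>Conjugating by \<open>b \<otimes> g\<close> is the same as conjugating by
  \<open>b\<close>, since \<open>g\<close> commutes with itself; hence \<open>A\<close> alone sweeps
  out the class.\<close>

lemma conj_class_outside:
  assumes g: "g \<in> outside"
  shows "conj_class G g = (\<lambda>b. b \<otimes> g \<otimes> inv b) ` A"
proof -
  have "\<exists>b\<in>A. h \<otimes> g \<otimes> inv h = b \<otimes> g \<otimes> inv b" if h: "h \<in> carrier G" for h
  proof (cases "h \<in> A")
    case False
    then obtain b where b: "b \<in> A" "h = b \<otimes> g" using outside_eq_mult g h by blast
    then have "h \<otimes> g \<otimes> inv h = b \<otimes> g \<otimes> inv b"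
      using g A_carrier by (simp add: m_assoc inv_mult_group)
    then show ?thesis using b by blast
  qed blast
  then show ?thesis using A_carrier by (auto simp: conj_class_def)
qed

lemma card_conj_class_outside:
  assumes g: "g \<in> outside"
  shows "card (conj_class G g) * card Z = card A"
proof -
  define f where "f = (\<lambda>b. b \<otimes> g \<otimes> inv b)"
  have fib: "card {b \<in> A. f b = y} = card Z" if y: "y \<in> f ` A" for y
  proof -
    obtain c where c: "c \<in> A" "y = f c" using y by blast
    \<comment> \<open>Orbit and stabiliser: two elements of \<open>A\<close> give the same conjugate
      of \<open>g\<close> iff their quotient commutes with \<open>g\<close>, that is, iff it is
      central.\<close>
    have "{b \<in> A. f b = y} = (\<lambda>z. c \<otimes> z) ` Z"
    proof (intro equalityI subsetI)
      fix b assume "b \<in> {b \<in> A. f b = y}"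
      then have b: "b \<in> A" "b \<otimes> g \<otimes> inv b = c \<otimes> g \<otimes> inv c" using c f_def by auto
      define z where "z = inv c \<otimes> b"
      have zA: "z \<in> A" using b c A_carrier by (simp add: z_def mult_mem_A_iff inv_mem_A_iff)
      have bz: "b = c \<otimes> z" using b c A_carrier by (simp add: z_def m_assoc[symmetric])
      have "z \<otimes> g \<otimes> inv z = inv c \<otimes> (b \<otimes> g \<otimes> inv b) \<otimes> c"
        using b(1) c g A_carrier by (simp add: z_def m_assoc inv_mult_group)
      also have "\<dots> = g" unfolding b(2) using c g A_carrier by (simp add: m_assoc)
      finally have "(z \<otimes> g \<otimes> inv z) \<otimes> z = g \<otimes> z" by simp
      then have "z \<otimes> g = g \<otimes> z" using zA g A_carrier by (simp add: m_assoc)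
      then have "z \<in> Z" using commute_outside_imp_central zA g by blast
      then show "b \<in> (\<lambda>z. c \<otimes> z) ` Z" using bz by blast
    next
      fix b assume "b \<in> (\<lambda>z. c \<otimes> z) ` Z"
      then obtain z where z: "z \<in> Z" "b = c \<otimes> z" by blast
      have zA: "z \<in> A" using z center_subset by blast
      have "b \<otimes> g \<otimes> inv b = c \<otimes> (z \<otimes> g \<otimes> inv z) \<otimes> inv c"
        unfolding z(2) using c zA g A_carrier by (simp add: m_assoc inv_mult_group)
      also have "z \<otimes> g \<otimes> inv z = g"
        using central_commute[OF z(1)] zA g A_carrier by (simp add: m_assoc)
      finally show "b \<in> {b \<in> A. f b = y}"
        using c z(2) zA A_carrier by (simp add: f_def mult_mem_A_iff)
    qed
    moreover have "inj_on (\<lambda>z. c \<otimes> z) Z"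
      using c A_carrier center_subset by (intro inj_onI) (auto simp: subset_iff)
    ultimately show ?thesis by (simp add: card_image)
  qed
  have "card A = (\<Sum>y\<in>f ` A. card {b \<in> A. f b = y})"
    using sum.image_gen[OF finite_A, of "\<lambda>_. 1::nat" f] by simp
  also have "\<dots> = card (f ` A) * card Z" using fib by simp
  finally show ?thesis using conj_class_outside[OF g] by (simp add: f_def)
qed

lemma card_outside: "card outside = card A"
proof -
  obtain g where g: "g \<in> outside" using outside_nonempty by blast
  have "outside = (\<lambda>b. b \<otimes> g) ` A"
  proof (intro equalityI subsetI)
    fix h assume "h \<in> outside"
    then show "h \<in> (\<lambda>b. b \<otimes> g) ` A" using outside_eq_mult[OF g, of h] by blast
  qed (use g A_carrier in \<open>auto simp: mult_mem_A_iff\<close>)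
  moreover have "inj_on (\<lambda>b. b \<otimes> g) A"
    using g A_carrier by (intro inj_onI) auto
  ultimately show ?thesis by (simp add: card_image)
qed

lemma vertices_eq: "nccc_vertices G = conj_class G ` (A - Z) \<union> conj_class G ` outside"
proof -
  have "carrier G - Z = (A - Z) \<union> outside" using A_sub center_subset by blast
  then show ?thesis by (simp add: nccc_vertices_def image_Un)
qed

section \<open>Adjacency between the kinds of classes\<close>

lemma not_nccc_adjI:
  assumes "x' \<in> conj_class G x" "y' \<in> conj_class G y" "x' \<otimes> y' = y' \<otimes> x'"
  shows "\<not> nccc_adj G (conj_class G x) (conj_class G y)"
  using assms by (auto simp: nccc_adj_def)

lemma not_nccc_adj_inside:
  "\<lbrakk>a \<in> A; b \<in> A\<rbrakk> \<Longrightarrow> \<not> nccc_adj G (conj_class G a) (conj_class G b)"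
  using not_nccc_adjI[of a a b b] self_mem_conj_class A_carrier A_comm by blast

lemma conj_class_inside_neq_outside:
  "\<lbrakk>a \<in> A - Z; g \<in> outside\<rbrakk> \<Longrightarrow> conj_class G a \<noteq> conj_class G g"
  using conj_inside_noncentral[of a] conj_outside[of g] self_mem_conj_class[of g] by blast

lemma nccc_adj_inside_outside:
  assumes "a \<in> A - Z" "g \<in> outside"
  shows "nccc_adj G (conj_class G a) (conj_class G g)"
    and "nccc_adj G (conj_class G g) (conj_class G a)"
proof -
  have "a' \<otimes> g' \<noteq> g' \<otimes> a'" if "a' \<in> conj_class G a" "g' \<in> conj_class G g" for a' g'
    using that conj_inside_noncentral conj_outside commute_outside_imp_central assms by blast
  then show "nccc_adj G (conj_class G a) (conj_class G g)"
    "nccc_adj G (conj_class G g) (conj_class G a)"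
    unfolding nccc_adj_def using conj_class_inside_neq_outside[OF assms] by metis+
qed

text \<open>The equation says that \<open>h\<close> equals \<open>z\<close> times the conjugate of
  \<open>g\<close> by \<open>b\<close>. That conjugate commutes with its own central multiple, so
  one commuting pair of representatives exists. The form without inverses is easy to check in
  coordinates.\<close>

lemma not_nccc_adj_outside:
  assumes g: "g \<in> outside" and h: "h \<in> outside" and b: "b \<in> A" and z: "z \<in> Z"
    and eq: "h \<otimes> b = z \<otimes> b \<otimes> g"
  shows "\<not> nccc_adj G (conj_class G g) (conj_class G h)"
proof (rule not_nccc_adjI)
  define g' where "g' = b \<otimes> g \<otimes> inv b"
  have zA: "z \<in> carrier G" using z by (simp add: grp_center_def)
  have g': "g' \<in> carrier G" using g b A_carrier by (simp add: g'_def)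
  show "g' \<in> conj_class G g" using b A_carrier by (auto simp: conj_class_def g'_def)
  show "h \<in> conj_class G h" using h self_mem_conj_class by simp
  have "h = h \<otimes> b \<otimes> inv b" using h b A_carrier by (simp add: m_assoc)
  also have "\<dots> = z \<otimes> g'" unfolding eq g'_def using zA b g A_carrier by (simp add: m_assoc)
  finally have "h = z \<otimes> g'" .
  then show "g' \<otimes> h = h \<otimes> g'"
    using central_commute[OF z g', symmetric] zA g' by (simp add: m_assoc[symmetric])
qed

lemma outside_classes_nonempty: "conj_class G ` outside \<noteq> {}"
  using outside_nonempty by simp

lemma inside_classes_nonempty: "conj_class G ` (A - Z) \<noteq> {}"
  using A_not_central by blast

text \<open>The hypothesis says that h is a central multiple of a conjugate of g; it makes
  the classes outside A pairwise non-adjacent.\<close>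
theorem nccc_integral_iff_bipartite:
  assumes link: "\<And>g h. \<lbrakk>g \<in> outside; h \<in> outside\<rbrakk> \<Longrightarrow> \<exists>b\<in>A. \<exists>z\<in>Z. h \<otimes> b = z \<otimes> b \<otimes> g"
    and q: "card A = card Z + 2 * q"
  shows "nccc_integral G \<longleftrightarrow> (\<exists>k::nat. card Z * q = k\<^sup>2)"
proof -
  let ?P = "conj_class G ` (A - Z)" and ?Q = "conj_class G ` outside"
  have cP: "card ?P = q" using card_inside_classes q by simp
  obtain g where g: "g \<in> outside" using outside_nonempty by blast
  have "A \<noteq> {}" using one_mem_A by blast
  then have pos: "card A > 0" using finite_A by (simp add: card_gt_0_iff)
  have sz: "card (conj_class G h) = card (conj_class G g)" if "h \<in> outside" for h
    using card_conj_class_outside[OF g] card_conj_class_outside[OF that] pos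
    by (metis mult_cancel2 mult_zero_right less_irrefl)
  have "card (conj_class G g) * card ?Q = card outside"
    by (rule card_conj_classes) (use conj_outside sz in auto)
  \<comment> \<open>All outside classes have the same size \<open>s\<close> with
    \<open>s * card Z = card A\<close>, and \<open>outside\<close> has as many elements as
    \<open>A\<close>.\<close>
  then have cQ: "card ?Q = card Z"
    using card_conj_class_outside[OF g] card_outside pos
    by (metis mult_cancel1 mult_zero_left less_irrefl)
  have "integral_graph (nccc_vertices G) (nccc_adj G) \<longleftrightarrow> (\<exists>k::nat. card ?P * card ?Q = k\<^sup>2)"
  proof (rule integral_complete_bipartite_iff[OF _ _ inside_classes_nonempty
        outside_classes_nonempty _ vertices_eq])
    show "?P \<inter> ?Q = {}" using conj_class_inside_neq_outside by auto
    fix u w assume "u \<in> nccc_vertices G" "w \<in> nccc_vertices G"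
    then consider "u \<in> ?P" "w \<in> ?P" | "u \<in> ?P" "w \<in> ?Q" | "u \<in> ?Q" "w \<in> ?P" | "u \<in> ?Q" "w \<in> ?Q"
      unfolding vertices_eq by blast
    then show "nccc_adj G u w \<longleftrightarrow> (u \<in> ?P) \<noteq> (w \<in> ?P)"
    proof cases
      case 1 then show ?thesis using not_nccc_adj_inside by blast
    next
      case 2
      then have "w \<notin> ?P" using \<open>?P \<inter> ?Q = {}\<close> by blast
      then show ?thesis using 2 nccc_adj_inside_outside(1) by blast
    next
      case 3
      then have "u \<notin> ?P" using \<open>?P \<inter> ?Q = {}\<close> by blast
      then show ?thesis using 3 nccc_adj_inside_outside(2) by blast
    next
      case 4
      then have "u \<notin> ?P" "w \<notin> ?P" using \<open>?P \<inter> ?Q = {}\<close> by blast+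
      moreover have "\<not> nccc_adj G u w" using 4 link not_nccc_adj_outside by blast
      ultimately show ?thesis by blast
    qed
  qed (use finite_A finite_carrier in auto)
  then show ?thesis by (simp add: nccc_integral_def cP cQ mult.commute)
qed

text \<open>Left multiplication by t swaps the two colours, so both colours contain
  equally many classes.\<close>
theorem nccc_integral_iff_tripartite:
  fixes col :: "'a \<Rightarrow> bool"
  assumes col_comm: "\<And>g h. \<lbrakk>g \<in> outside; h \<in> outside; g \<otimes> h = h \<otimes> g\<rbrakk> \<Longrightarrow> col g = col h"
    and col_conj: "\<And>g h k. \<lbrakk>g \<in> outside; h \<in> outside; k \<in> carrier G; k \<otimes> g = h \<otimes> k\<rbrakk> \<Longrightarrow> col g = col h"
    and link: "\<And>g h. \<lbrakk>g \<in> outside; h \<in> outside; col g = col h\<rbrakk> \<Longrightarrow> \<exists>b\<in>A. \<exists>z\<in>Z. h \<otimes> b = z \<otimes> b \<otimes> g"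
    and t: "t \<in> A" "\<And>g. g \<in> outside \<Longrightarrow> col (t \<otimes> g) \<noteq> col g"
    and p: "card Z = 2 * p" and q: "card A = card Z + 2 * q"
  shows "nccc_integral G \<longleftrightarrow> (\<exists>k::nat. p\<^sup>2 + 8 * p * q = k\<^sup>2)"
proof -
  let ?S = "\<lambda>c. {g \<in> outside. col g = c}"
  let ?C = "\<lambda>c. conj_class G ` ?S c" and ?R = "conj_class G ` (A - Z)"
  have cR: "card ?R = q" using card_inside_classes q by simp
  obtain g where g: "g \<in> outside" using outside_nonempty by blast
  have "A \<noteq> {}" using one_mem_A by blast
  then have pos: "card A > 0" using finite_A by (simp add: card_gt_0_iff)
  define s where "s = card (conj_class G g)"
  have sz: "card (conj_class G h) = s" if "h \<in> outside" for h
    unfolding s_def using card_conj_class_outside[OF g] card_conj_class_outside[OF that] pos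
    by (metis mult_cancel2 mult_zero_right less_irrefl)
  have sZ: "s * card Z = card A" using card_conj_class_outside[OF g] by (simp add: s_def)
  have col_class: "col h = col g" if gh: "g \<in> outside" "h \<in> conj_class G g" for g h
  proof -
    obtain k where k: "k \<in> carrier G" "h = k \<otimes> g \<otimes> inv k" using gh by (auto simp: conj_class_def)
    have "k \<otimes> g = h \<otimes> k" using k gh by (simp add: m_assoc)
    moreover have "h \<in> outside" using gh(2) conj_outside[OF gh(1)] by (rule set_rev_mp)
    ultimately show ?thesis using col_conj[OF gh(1) _ k(1)] by blast
  qed
  have sC: "s * card (?C c) = card (?S c)" for c
  proof (rule card_conj_classes)
    show "conj_class G x \<subseteq> ?S c" if "x \<in> ?S c" for x
      using that conj_outside[of x] col_class[of x] by blast
  qed (use sz in auto)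
  have finO: "finite outside" using finite_carrier by simp
  \<comment> \<open>An injection in one direction is enough, since \<open>c\<close> ranges over both
    colours.\<close>
  have le: "card (?S c) \<le> card (?S (\<not> c))" for c
  proof (rule card_inj_on_le[of "\<lambda>g. t \<otimes> g"])
    show "inj_on (\<lambda>g. t \<otimes> g) (?S c)" using t A_carrier by (intro inj_onI) simp
    show "(\<lambda>g. t \<otimes> g) ` ?S c \<subseteq> ?S (\<not> c)" using t A_carrier by (auto simp: mult_mem_A_iff)
    show "finite (?S (\<not> c))" by (rule finite_subset[OF _ finO]) blast
  qed
  have eqS: "card (?S True) = card (?S False)" using le[of True] le[of False] by simp
  have "card outside = card (?S True \<union> ?S False)" by (rule arg_cong[of _ _ card]) auto
  also have "\<dots> = card (?S True) + card (?S False)" by (intro card_Un_disjoint finite_subset[OF _ finO]) auto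
  finally have "s * (2 * card (?C c)) = s * (2 * p)" for c
    using sC[of True] sC[of False] eqS card_outside sZ p by (cases c) auto
  moreover have "s > 0" using sZ pos by (cases s) auto
  ultimately have cC: "card (?C c) = p" for c by (metis mult_cancel1 less_irrefl zero_neq_numeral)
  have p0: "p > 0" using p sZ pos by (cases p) auto
  have V: "nccc_vertices G = ?C True \<union> ?C False \<union> ?R" unfolding vertices_eq by blast
  have disC: "?C True \<inter> ?C False = {}"
  proof (rule ccontr)
    assume "?C True \<inter> ?C False \<noteq> {}"
    then obtain x y where xy: "x \<in> ?S True" "y \<in> ?S False" "conj_class G x = conj_class G y" by blast
    then have "x \<in> conj_class G y" using self_mem_conj_class[of x] by blast
    then show False using col_class[of y x] xy by blast
  qed
  have disR: "?C c \<inter> ?R = {}" for c using conj_class_inside_neq_outside by blast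
  have adj_cols: "nccc_adj G (conj_class G x) (conj_class G y)"
    if xy: "x \<in> ?S c" "y \<in> ?S d" "c \<noteq> d" for x y c d
  proof -
    have "x' \<otimes> y' \<noteq> y' \<otimes> x'" if "x' \<in> conj_class G x" "y' \<in> conj_class G y" for x' y'
      using that xy col_class[of x x'] col_class[of y y'] conj_outside[of x] conj_outside[of y]
        col_comm[of x' y'] by blast
    moreover have "conj_class G x \<noteq> conj_class G y"
      using disC xy by (cases c; cases d) blast+
    ultimately show ?thesis by (auto simp: nccc_adj_def)
  qed
  have "integral_graph (nccc_vertices G) (nccc_adj G) \<longleftrightarrow> (\<exists>k::nat. p\<^sup>2 + 8 * p * q = k\<^sup>2)"
  proof (rule integral_complete_tripartite_iff[OF _ _ _ _ inside_classes_nonempty disC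
        disR disR cC cC cR V])
    fix u w assume "u \<in> nccc_vertices G" "w \<in> nccc_vertices G"
    then consider c d where "u \<in> ?C c" "w \<in> ?C d" | c where "u \<in> ?C c" "w \<in> ?R"
      | c where "u \<in> ?R" "w \<in> ?C c" | "u \<in> ?R" "w \<in> ?R"
      unfolding V by blast
    then show "nccc_adj G u w \<longleftrightarrow>
        (u \<in> ?C True) \<noteq> (w \<in> ?C True) \<or> (u \<in> ?C False) \<noteq> (w \<in> ?C False)"
    proof cases
      case (1 c d)
      show ?thesis
      proof (cases "c = d")
        case True
        have "\<not> nccc_adj G u w" using 1 True link not_nccc_adj_outside by blast
        then show ?thesis using 1 True disC by (cases c) blast+
      next
        case False
        have "nccc_adj G u w" using 1 False adj_cols by blast
        then show ?thesis using 1 False disC by (cases c; cases d) blast+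
      qed
    next
      case (2 c)
      have "nccc_adj G u w" using 2 nccc_adj_inside_outside(2) by blast
      then show ?thesis using 2 disR[of True] disR[of False] by (cases c) blast+
    next
      case (3 c)
      have "nccc_adj G u w" using 3 nccc_adj_inside_outside(1) by blast
      then show ?thesis using 3 disR[of True] disR[of False] by (cases c) blast+
    next
      case 4
      have "\<not> nccc_adj G u w" using 4 not_nccc_adj_inside by blast
      then show ?thesis using 4 disR[of True] disR[of False] by blast
    qed
  next
    show "?C True \<noteq> {}" using cC[of True] p0 by (metis card.empty less_irrefl)
  qed (simp_all add: finite_A finite_carrier)
  then show ?thesis by (simp add: nccc_integral_def)
qed

end

section \<open>Dihedral, dicyclic and semidihedral groups\<close>

lemma card_multiples_int:
  fixes c M :: int
  assumes "M > 0" "c \<ge> 0"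
  shows "card {i \<in> {0..<c * M}. M dvd i} = nat c"
proof -
  have "{i \<in> {0..<c * M}. M dvd i} = (\<lambda>j. j * M) ` {0..<c}"
    using assms by (auto simp: mult_less_cancel_right zero_le_mult_iff mult.commute[of _ M] elim!: dvdE)
  moreover have "inj_on (\<lambda>j. j * M) {0..<c}" using assms by (intro inj_onI) simp
  ultimately show ?thesis by (simp add: card_image)
qed

text \<open>(i, j) stands for x^i y^j, where x has order N, y x y^-1 = x^r and y^2 = x^s.\<close>
definition metacyclic :: "int \<Rightarrow> int \<Rightarrow> int \<Rightarrow> (int \<times> int) monoid" where
  "metacyclic N r s = \<lparr> carrier = {0..<N} \<times> {0..<2},
     monoid.mult = (\<lambda>(i1, j1) (i2, j2).
        ((i1 + (if j1 = 0 then i2 else r * i2) + s * j1 * j2) mod N, (j1 + j2) mod 2)),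
     one = (0, 0) \<rparr>"

lemma metacyclic_simps:
  "carrier (metacyclic N r s) = {0..<N} \<times> {0..<2}"
  "(i1, j1) \<otimes>\<^bsub>metacyclic N r s\<^esub> (i2, j2) =
     ((i1 + (if j1 = 0 then i2 else r * i2) + s * j1 * j2) mod N, (j1 + j2) mod 2)"
  "\<one>\<^bsub>metacyclic N r s\<^esub> = (0, 0)"
  by (simp_all add: metacyclic_def)

lemma dihedral_eq_metacyclic: "dihedral m = metacyclic (int m) (-1) 0"
  by (auto simp: dihedral_def metacyclic_def fun_eq_iff)

lemma dicyclic_eq_metacyclic: "dicyclic m = metacyclic (2 * int m) (-1) (int m)"
  by (auto simp: dicyclic_def metacyclic_def fun_eq_iff)

lemma semidihedral_eq_metacyclic: "semidihedral m = metacyclic (4 * int m) (2 * int m - 1) 0"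
  by (simp add: semidihedral_def metacyclic_def)

text \<open>Rewrite rules for the shapes that nested products create, where a reduced exponent
  occurs inside a sum or behind a scalar factor.\<close>

lemma mod_affine_eq:
  fixes a :: int
  shows "(x mod n + a + b) mod n = (x + a + b) mod n"
    and "(a + x mod n + b) mod n = (a + x + b) mod n"
    and "(a + c * (x mod n)) mod n = (a + c * x) mod n"
    and "(a + c * (x mod n) + b) mod n = (a + c * x + b) mod n"
proof -
  show "(x mod n + a + b) mod n = (x + a + b) mod n" by (simp add: add.assoc mod_simps)
  show "(a + x mod n + b) mod n = (a + x + b) mod n" by (metis add.commute add.assoc mod_add_left_eq)
  show *: "(a + c * (x mod n)) mod n = (a + c * x) mod n" for a
    by (metis mod_add_right_eq mod_mult_right_eq)
  show "(a + c * (x mod n) + b) mod n = (a + c * x + b) mod n"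
    using *[of "a + b"] by (simp add: add_ac)
qed

lemma mod_bit_cases: "j \<in> {0..<2} \<Longrightarrow> j = 0 \<or> j = (1::int)"
  by auto

text \<open>\<open>r_sq\<close> holds because conjugating twice by y is conjugating by y^2 = x^s,
  which fixes x; \<open>rs\<close> because y commutes with y^2 = x^s. \<open>r_nontrivial\<close>
  says that x and y do not commute.\<close>

locale metacyclic_params =
  fixes N r s :: int
  assumes N: "N > 0" and r_sq: "N dvd r * r - 1" and rs: "N dvd (r - 1) * s"
    and r_nontrivial: "\<not> N dvd r - 1"
begin

abbreviation "M \<equiv> metacyclic N r s"

lemma group_metacyclic: "group M"
proof (rule groupI)
  fix x y z assume xyz: "x \<in> carrier M" "y \<in> carrier M" "z \<in> carrier M"
  show "x \<otimes>\<^bsub>M\<^esub> y \<in> carrier M"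
    using xyz N by (cases x; cases y) (simp add: metacyclic_simps)
  obtain i1 j1 i2 j2 i3 j3 where [simp]: "x = (i1, j1)" "y = (i2, j2)" "z = (i3, j3)"
    by (cases x; cases y; cases z) auto
  have j: "j1 = 0 \<or> j1 = 1" "j2 = 0 \<or> j2 = 1" "j3 = 0 \<or> j3 = 1"
    using xyz mod_bit_cases by (auto simp: metacyclic_simps)
  \<comment> \<open>Associativity needs the parameter conditions only when
    \<open>j1 = j2 = 1\<close>: \<open>r_sq\<close> removes the factor \<open>r * r\<close> in front
    of \<open>i3\<close>, and \<open>rs\<close> the factor \<open>r\<close> in front of
    \<open>s\<close>.\<close>
  have 1: "(i3 + (i1 + r * i2)) mod N = (i1 + r * (i2 + r * i3)) mod N"
    "(s + (i3 + (i1 + r * i2))) mod N = (i1 + r * (s + (i2 + r * i3))) mod N"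
    "(i1 + r * (s + (i2 + r * i3))) mod N = (s + (i1 + r * (i2 + r * i3))) mod N"
  proof -
    have "N dvd (r * r - 1) * i3" using r_sq by simp
    then have "N dvd - ((r * r - 1) * i3)" using dvd_minus_iff by blast
    moreover from this have "N dvd - ((r * r - 1) * i3) - (r - 1) * s" using rs by (rule dvd_diff)
    ultimately
    show "(i3 + (i1 + r * i2)) mod N = (i1 + r * (i2 + r * i3)) mod N"
      "(s + (i3 + (i1 + r * i2))) mod N = (i1 + r * (s + (i2 + r * i3))) mod N"
      "(i1 + r * (s + (i2 + r * i3))) mod N = (s + (i1 + r * (i2 + r * i3))) mod N"
      using rs unfolding mod_eq_dvd_iff by (simp_all add: algebra_simps)
  qed
  show "x \<otimes>\<^bsub>M\<^esub> y \<otimes>\<^bsub>M\<^esub> z = x \<otimes>\<^bsub>M\<^esub> (y \<otimes>\<^bsub>M\<^esub> z)"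
    using j by (elim disjE; simp add: metacyclic_simps mod_simps mod_affine_eq;
      use 1 in \<open>simp add: algebra_simps\<close>)
next
  show "\<one>\<^bsub>M\<^esub> \<in> carrier M" using N by (simp add: metacyclic_simps)
next
  fix x assume x: "x \<in> carrier M"
  then show "\<one>\<^bsub>M\<^esub> \<otimes>\<^bsub>M\<^esub> x = x" by (cases x) (simp add: metacyclic_simps)
  obtain i j where [simp]: "x = (i, j)" by (cases x)
  have "j = 0 \<or> j = 1" using x mod_bit_cases by (auto simp: metacyclic_simps)
  then show "\<exists>y\<in>carrier M. y \<otimes>\<^bsub>M\<^esub> x = \<one>\<^bsub>M\<^esub>"
  proof
    assume "j = 0"
    then show ?thesis using N
      by (intro bexI[of _ "((- i) mod N, 0)"]) (auto simp: metacyclic_simps mod_simps)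
  next
    assume "j = 1"
    \<comment> \<open>The first coordinate of the inverse solves \<open>i' + r * i + s = 0\<close>
      modulo \<open>N\<close>.\<close>
    then show ?thesis using N
      by (intro bexI[of _ "((- r * i - s) mod N, 1)"]) (auto simp: metacyclic_simps mod_simps mod_affine_eq)
  qed
qed

text \<open>Commuting with the generator x excludes the exponent 1 of y; commuting with y then
  requires x^(r i) = x^i.\<close>

lemma center_metacyclic: "grp_center M = {i \<in> {0..<N}. N dvd (r - 1) * i} \<times> {0}"
proof (intro equalityI subsetI)
  fix x assume x: "x \<in> grp_center M"
  obtain i j where [simp]: "x = (i, j)" by (cases x)
  have ij: "i \<in> {0..<N}" "j = 0 \<or> j = 1"
    using x mod_bit_cases by (auto simp: grp_center_def metacyclic_simps)
  have comm: "x \<otimes>\<^bsub>M\<^esub> g = g \<otimes>\<^bsub>M\<^esub> x" if "g \<in> carrier M" for g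
    using x that by (simp add: grp_center_def)
  have N1: "N > 1" using N r_nontrivial by (cases "N = 1") auto
  have "j = 0"
  proof (rule ccontr)
    assume "j \<noteq> 0"
    then have "(i + r) mod N = (1 + i) mod N"
      using comm[of "(1, 0)"] N1 ij by (simp add: metacyclic_simps)
    then show False using r_nontrivial by (simp add: mod_eq_dvd_iff)
  qed
  then have "i mod N = (r * i) mod N"
    using comm[of "(0, 1)"] N by (simp add: metacyclic_simps)
  then have "N dvd (r - 1) * i" by (metis mod_eq_dvd_iff left_diff_distrib mult_1)
  then show "x \<in> {i \<in> {0..<N}. N dvd (r - 1) * i} \<times> {0}" using ij \<open>j = 0\<close> by simp
next
  fix x assume "x \<in> {i \<in> {0..<N}. N dvd (r - 1) * i} \<times> {0::int}"
  then obtain i where x: "x = (i, 0)" "0 \<le> i" "i < N" "N dvd (r - 1) * i" by auto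
  have "(i + a) mod N = (a + r * i) mod N" for a
    using x(4) unfolding mod_eq_dvd_iff by (simp add: algebra_simps dvd_diff_commute)
  then show "x \<in> grp_center M" using x
    by (auto simp: grp_center_def metacyclic_simps add_ac)
qed

sublocale abelian_index_two M "{0..<N} \<times> {0}"
proof (intro abelian_index_two.intro abelian_index_two_axioms.intro group_metacyclic)
  show "finite (carrier M)" by (simp add: metacyclic_simps)
  show "{0..<N} \<times> {0} \<subseteq> carrier M" by (auto simp: metacyclic_simps)
  show "x \<otimes>\<^bsub>M\<^esub> y \<in> {0..<N} \<times> {0} \<longleftrightarrow> (x \<in> {0..<N} \<times> {0}) = (y \<in> {0..<N} \<times> {0})"
    if "x \<in> carrier M" "y \<in> carrier M" for x y
  proof -
    obtain i1 j1 i2 j2 where [simp]: "x = (i1, j1)" "y = (i2, j2)" by (cases x; cases y)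
    have "j1 = 0 \<or> j1 = 1" "j2 = 0 \<or> j2 = 1"
      using that mod_bit_cases by (auto simp: metacyclic_simps)
    then show ?thesis using that N by (elim disjE) (simp_all add: metacyclic_simps)
  qed
  show "x \<otimes>\<^bsub>M\<^esub> y = y \<otimes>\<^bsub>M\<^esub> x" if "x \<in> {0..<N} \<times> {0}" "y \<in> {0..<N} \<times> {0}" for x y
    using that by (auto simp: metacyclic_simps add_ac)
  have "N > 1" using N r_nontrivial by (cases "N = 1") auto
  then show "\<not> {0..<N} \<times> {0} \<subseteq> grp_center M"
    using r_nontrivial by (auto simp: center_metacyclic dest: subsetD[of _ _ "(1, 0)"])
qed

lemma outside_cases:
  assumes "g \<in> carrier M - {0..<N} \<times> {0}"
  obtains i where "g = (i, 1)" "i \<in> {0..<N}"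
  using assms mod_bit_cases[of "snd g"] by (cases g) (auto simp: metacyclic_simps)

lemma card_A: "card ({0..<N} \<times> {0::int}) = nat N"
  by (simp add: card_cartesian_product)

lemma card_center: "card (grp_center M) = card {i \<in> {0..<N}. N dvd (r - 1) * i}"
  by (simp add: center_metacyclic card_cartesian_product)

text \<open>The pair \<open>e\<close>, \<open>k\<close> realises the exponent shift \<open>c\<close>
  by a central factor x^e and conjugation by x^k. Scaling both by (j - i) / c realises the shift
  from \<open>i\<close> to \<open>j\<close>. It is used with \<open>c = 1\<close> and
  \<open>c = 2\<close>.\<close>

lemma link_metacyclic:
  assumes e: "N dvd (r - 1) * e" and k: "N dvd c + (r - 1) * k - e" and c: "c dvd j - i"
  shows "\<exists>b\<in>{0..<N} \<times> {0}. \<exists>z\<in>grp_center M. (j, 1) \<otimes>\<^bsub>M\<^esub> b = z \<otimes>\<^bsub>M\<^esub> b \<otimes>\<^bsub>M\<^esub> (i, 1)"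
proof -
  obtain d where d: "j - i = c * d" using c by blast
  have 1: "N dvd (r - 1) * (e * d mod N)"
  proof -
    have "N dvd (r - 1) * (e * d)" using e by (simp add: mult.assoc[symmetric])
    then show ?thesis by (simp add: dvd_eq_mod_eq_0 mod_simps)
  qed
  have "N dvd (c + (r - 1) * k - e) * d" using k by simp
  also have "(c + (r - 1) * k - e) * d = (j + r * (k * d)) - (e * d + k * d + i)"
    using d by (simp add: algebra_simps)
  finally have 2: "(j + r * (k * d)) mod N = (e * d + k * d + i) mod N" by (simp add: mod_eq_dvd_iff)
  show ?thesis
    by (rule bexI[of _ "(k * d mod N, 0)"], rule bexI[of _ "(e * d mod N, 0)"])
      (use N 1 2 in \<open>simp_all add: center_metacyclic metacyclic_simps mod_simps mod_affine_eq\<close>)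
qed

theorem metacyclic_bipartite:
  assumes "N dvd (r - 1) * e" "N dvd 1 + (r - 1) * k - e"
    and z: "card {i \<in> {0..<N}. N dvd (r - 1) * i} = z" and q: "nat N = z + 2 * q"
  shows "nccc_integral M \<longleftrightarrow> (\<exists>k::nat. z * q = k\<^sup>2)"
proof -
  have "nccc_integral M \<longleftrightarrow> (\<exists>k::nat. card (grp_center M) * q = k\<^sup>2)"
  proof (rule nccc_integral_iff_bipartite)
    fix g h assume gh: "g \<in> carrier M - {0..<N} \<times> {0}" "h \<in> carrier M - {0..<N} \<times> {0}"
    then obtain i j where "g = (i, 1)" "h = (j, 1)" by (metis outside_cases)
    then show "\<exists>b\<in>{0..<N} \<times> {0}. \<exists>z\<in>grp_center M. h \<otimes>\<^bsub>M\<^esub> b = z \<otimes>\<^bsub>M\<^esub> b \<otimes>\<^bsub>M\<^esub> g"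
      using link_metacyclic[OF assms(1,2), of j i] by simp
  qed (simp add: card_A card_center z[simplified] q)
  then show ?thesis by (simp only: card_center z)
qed

text \<open>The colour is the parity of the exponent of x. Commuting elements outside A differ by a
  central power of x, so the hypothesis \<open>even\<close> gives them the same colour, and left
  multiplication by x swaps the colours.\<close>

theorem metacyclic_tripartite:
  assumes "even N" "N dvd (r - 1) * e" "N dvd 2 + (r - 1) * k - e"
    and even: "\<And>d. N dvd (r - 1) * d \<Longrightarrow> even d"
    and z: "card {i \<in> {0..<N}. N dvd (r - 1) * i} = 2 * p" and q: "nat N = 2 * p + 2 * q"
  shows "nccc_integral M \<longleftrightarrow> (\<exists>k::nat. p\<^sup>2 + 8 * p * q = k\<^sup>2)"
proof (rule nccc_integral_iff_tripartite[where col = "\<lambda>g. even (fst g)" and t = "(1, 0)"])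
  have dvd2: "2 dvd a - b" if "a mod N = b mod N" for a b
    using that \<open>even N\<close> unfolding mod_eq_dvd_iff by (rule dvd_trans[rotated])
  \<comment> \<open>Oddness of \<open>r\<close> is what makes conjugation, by x as well as by y,
    preserve the parity of the exponent.\<close>
  have "even (r * r - 1)" using r_sq \<open>even N\<close> dvd_trans by blast
  then have odd: "odd r" by simp
  have N1: "N > 1" using N \<open>even N\<close> by (cases "N = 1") auto
  show "(1, 0) \<in> {0..<N} \<times> {0::int}" using N1 by simp
  show "even (fst ((1, 0) \<otimes>\<^bsub>M\<^esub> g)) \<noteq> even (fst g)" if "g \<in> carrier M - {0..<N} \<times> {0}" for g
    using that \<open>even N\<close> by (cases g) (simp add: metacyclic_simps dvd_mod_iff)
  show "card (grp_center M) = 2 * p" by (simp only: card_center z)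
  show "card ({0..<N} \<times> {0::int}) = card (grp_center M) + 2 * q" by (simp only: card_center card_A z q)
  fix g h assume gh: "g \<in> carrier M - {0..<N} \<times> {0}" "h \<in> carrier M - {0..<N} \<times> {0}"
  obtain i j where [simp]: "g = (i, 1)" "h = (j, 1)" and ij: "i \<in> {0..<N}" "j \<in> {0..<N}"
    using gh by (metis outside_cases)
  show "even (fst g) = even (fst h)" if "g \<otimes>\<^bsub>M\<^esub> h = h \<otimes>\<^bsub>M\<^esub> g"
  proof -
    have "(i + r * j + s) mod N = (j + r * i + s) mod N" using that by (simp add: metacyclic_simps)
    then have "N dvd (r - 1) * (j - i)" unfolding mod_eq_dvd_iff by (simp add: algebra_simps)
    then show ?thesis using even by fastforce
  qed
  show "even (fst g) = even (fst h)" if "k \<in> carrier M" "k \<otimes>\<^bsub>M\<^esub> g = h \<otimes>\<^bsub>M\<^esub> k" for k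
  proof -
    obtain a b where [simp]: "k = (a, b)" by (cases k)
    have "b = 0 \<or> b = 1" using that mod_bit_cases by (auto simp: metacyclic_simps)
    then show ?thesis
      using that(2) odd by (elim disjE) (auto simp: metacyclic_simps dest!: dvd2)
  qed
  show "\<exists>b\<in>{0..<N} \<times> {0}. \<exists>z\<in>grp_center M. h \<otimes>\<^bsub>M\<^esub> b = z \<otimes>\<^bsub>M\<^esub> b \<otimes>\<^bsub>M\<^esub> g"
    if "even (fst g) = even (fst h)"
    using link_metacyclic[OF assms(2,3), of j i] that by simp
qed

end

section \<open>The groups U and V\<close>

lemma U_group_simps:
  "carrier (U_group n m) = {0..<2 * int n} \<times> {0..<int m}"
  "(i1, j1) \<otimes>\<^bsub>U_group n m\<^esub> (i2, j2) =
     ((i1 + i2) mod (2 * int n), ((if even i2 then j1 else - j1) + j2) mod int m)"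
  "\<one>\<^bsub>U_group n m\<^esub> = (0, 0)"
  by (simp_all add: U_group_def)

lemma mod_neg_add_eq:
  fixes a b n :: int
  shows "(- (a mod n) + b) mod n = (- a + b) mod n"
  by (metis mod_add_left_eq mod_minus_eq)

locale U_params =
  fixes n m :: nat
  assumes n: "n > 0" and m: "m \<ge> 3"
begin

abbreviation "U \<equiv> U_group n m"
text \<open>The subgroup <x^2, y>: conjugation by x inverts y, so x^2 is central.\<close>

abbreviation "B \<equiv> {i \<in> {0..<2 * int n}. even i} \<times> {0..<int m}"

lemma even_mod_2n [simp]: "even (i mod (2 * int n)) \<longleftrightarrow> even i"
  by (simp add: dvd_mod_iff)

lemma group_U: "group U"
proof (rule groupI)
  fix x y z assume xyz: "x \<in> carrier U" "y \<in> carrier U" "z \<in> carrier U"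
  show "x \<otimes>\<^bsub>U\<^esub> y \<in> carrier U"
    using xyz n m by (cases x; cases y) (simp add: U_group_simps)
  show "x \<otimes>\<^bsub>U\<^esub> y \<otimes>\<^bsub>U\<^esub> z = x \<otimes>\<^bsub>U\<^esub> (y \<otimes>\<^bsub>U\<^esub> z)"
    by (cases x; cases y; cases z) (simp add: U_group_simps mod_simps mod_neg_add_eq, simp add: algebra_simps)
next
  show "\<one>\<^bsub>U\<^esub> \<in> carrier U" using n m by (simp add: U_group_simps)
next
  fix x assume x: "x \<in> carrier U"
  then show "\<one>\<^bsub>U\<^esub> \<otimes>\<^bsub>U\<^esub> x = x" by (cases x) (simp add: U_group_simps)
  obtain i j where [simp]: "x = (i, j)" by (cases x)
  show "\<exists>y\<in>carrier U. y \<otimes>\<^bsub>U\<^esub> x = \<one>\<^bsub>U\<^esub>"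
    using n m by (intro bexI[of _ "((- i) mod (2 * int n), (if even i then - j else j) mod int m)"])
      (auto simp: U_group_simps mod_simps mod_neg_add_eq)
qed

lemma center_U: "grp_center U = {i \<in> {0..<2 * int n}. even i} \<times> {j \<in> {0..<int m}. int m dvd 2 * j}"
proof (intro equalityI subsetI)
  fix x assume x: "x \<in> grp_center U"
  obtain i j where [simp]: "x = (i, j)" by (cases x)
  have ij: "i \<in> {0..<2 * int n}" "j \<in> {0..<int m}"
    using x by (auto simp: grp_center_def U_group_simps)
  have comm: "x \<otimes>\<^bsub>U\<^esub> g = g \<otimes>\<^bsub>U\<^esub> x" if "g \<in> carrier U" for g
    using x that by (simp add: grp_center_def)
  have "even i"
  proof (rule ccontr)
    assume "odd i"
    then have "(j + 1) mod int m = (- 1 + j) mod int m"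
      using comm[of "(0, 1)"] n m ij by (simp add: U_group_simps)
    then have "int m dvd 2" by (simp add: mod_eq_dvd_iff)
    then show False using m by (auto dest: zdvd_imp_le)
  qed
  moreover have "- j mod int m = j mod int m"
    using comm[of "(1, 0)"] n m by (simp add: U_group_simps)
  then have "int m dvd 2 * j" by (simp add: mod_eq_dvd_iff)
  ultimately show "x \<in> {i \<in> {0..<2 * int n}. even i} \<times> {j \<in> {0..<int m}. int m dvd 2 * j}"
    using ij by simp
next
  fix x assume "x \<in> {i \<in> {0..<2 * int n}. even i} \<times> {j \<in> {0..<int m}. int m dvd 2 * j}"
  then obtain i j where x: "x = (i, j)" "i \<in> {0..<2 * int n}" "even i" "j \<in> {0..<int m}"
    "int m dvd 2 * j" by auto
  have "(j + b) mod int m = (- j + b) mod int m" for b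
    using x(5) by (simp add: mod_eq_dvd_iff)
  then show "x \<in> grp_center U" using x
    by (auto simp: grp_center_def U_group_simps add_ac)
qed

sublocale abelian_index_two U B
proof (intro abelian_index_two.intro abelian_index_two_axioms.intro group_U)
  show "finite (carrier U)" by (simp add: U_group_simps)
  show "B \<subseteq> carrier U" by (auto simp: U_group_simps)
  show "x \<otimes>\<^bsub>U\<^esub> y \<in> B \<longleftrightarrow> (x \<in> B) = (y \<in> B)" if "x \<in> carrier U" "y \<in> carrier U" for x y
    using that n m by (cases x; cases y) (auto simp: U_group_simps)
  show "x \<otimes>\<^bsub>U\<^esub> y = y \<otimes>\<^bsub>U\<^esub> x" if "x \<in> B" "y \<in> B" for x y
    using that by (auto simp: U_group_simps add_ac)
  have "\<not> int m dvd 2" using m by (auto dest: zdvd_imp_le)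
  then have "(0, 1) \<in> B - grp_center U" using n m by (simp add: center_U)
  then show "\<not> B \<subseteq> grp_center U" by blast
qed

lemma card_even: "card {i \<in> {0..<2 * int n}. even i} = n"
  using card_multiples_int[of 2 "int n"] by (simp add: mult.commute)

text \<open>Here \<open>w\<close> is gcd(2, m), the number of solutions of 2 j = 0 modulo
  \<open>m\<close>, so odd \<open>m\<close> and \<open>m\<close> twice an odd number are handled
  together. The centre has order n w and there are n w (r - 1) / 2 classes inside \<open>B\<close>
  off the centre.\<close>

theorem U_bipartite:
  assumes w: "w = 1 \<or> w = 2" and r: "odd r" "m = w * r"
  shows "nccc_integral U \<longleftrightarrow> (\<exists>k::nat. n\<^sup>2 * (w\<^sup>2 * ((r - 1) div 2)) = k\<^sup>2)"
proof -
  have cop: "coprime (int r) 2" using r by simp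
  have dvd_iff: "int m dvd 2 * j \<longleftrightarrow> int r dvd j" for j
    using w cop unfolding r(2) by (auto simp: coprime_dvd_mult_right_iff)
  have zj: "card {j \<in> {0..<int m}. int m dvd 2 * j} = w"
    unfolding dvd_iff using card_multiples_int[of "int r" "int w"] r(1) by (simp add: r(2) odd_pos)
  have Z: "card (grp_center U) = n * w"
    unfolding center_U card_cartesian_product card_even zj ..
  have "card B = n * m" unfolding card_cartesian_product card_even by simp
  moreover have "r = 1 + 2 * ((r - 1) div 2)" using r(1) by (auto elim: oddE)
  then have "w * r = w + 2 * (w * ((r - 1) div 2))" by (metis distrib_left mult.left_commute mult_1_right)
  then have "n * m = n * w + 2 * (n * w * ((r - 1) div 2))"
    unfolding r(2) by (simp add: algebra_simps)
  ultimately have q: "card B = card (grp_center U) + 2 * (n * w * ((r - 1) div 2))"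
    using Z by simp
  have "nccc_integral U \<longleftrightarrow> (\<exists>k::nat. card (grp_center U) * (n * w * ((r - 1) div 2)) = k\<^sup>2)"
  proof (rule nccc_integral_iff_bipartite[OF _ q])
    fix g h assume gh: "g \<in> carrier U - B" "h \<in> carrier U - B"
    obtain i j i' j' where [simp]: "g = (i, j)" "h = (i', j')" by (cases g; cases h)
    have par: "odd i" "odd i'" and h: "0 \<le> i'" "i' < 2 * int n" using gh by (auto simp: U_group_simps)
    define D where "D = j' - j"
    \<comment> \<open>With b = y^k and a central y^f the exponents of y match iff D + 2 k = -f. As
      \<open>r\<close> is odd, k = D (r - 1) / 2 gives f = -D r, and y^f is central because m
      divides 2 r.\<close>
    define k where "k = D * ((int r - 1) div 2)"
    have k2: "2 * k = D * (int r - 1)" using r(1) by (simp add: k_def)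
    define f where "f = - D * int r"
    have f: "int m dvd 2 * (f mod int m)"
    proof -
      have "int m dvd 2 * f" by (simp add: dvd_iff f_def)
      then show ?thesis by (simp add: dvd_eq_mod_eq_0 mod_simps)
    qed
    have "j' + k = j - (f + k)" using k2 by (simp add: f_def D_def algebra_simps)
    then have 1: "(j' + k) mod int m = (j - (f + k)) mod int m" by (rule arg_cong)
    show "\<exists>b\<in>B. \<exists>z\<in>grp_center U. h \<otimes>\<^bsub>U\<^esub> b = z \<otimes>\<^bsub>U\<^esub> b \<otimes>\<^bsub>U\<^esub> g"
      by (rule bexI[of _ "(0, k mod int m)"], rule bexI[of _ "((i' - i) mod (2 * int n), f mod int m)"])
        (use n m f par h 1 in \<open>simp_all add: center_U U_group_simps mod_simps mod_neg_add_eq\<close>)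
  qed
  then show ?thesis by (simp add: Z power2_eq_square algebra_simps)
qed

end

section \<open>The groups V_8m\<close>

lemma V_group_simps:
  "carrier (V_group m) = {0..<2 * int m} \<times> {0..<4}"
  "(i1, j1) \<otimes>\<^bsub>V_group m\<^esub> (i2, j2) =
     ((i1 + (if even j1 then i2 else - i2)) mod (2 * int m), (j1 + j2 + 2 * i2 * (j1 mod 2)) mod 4)"
  "\<one>\<^bsub>V_group m\<^esub> = (0, 0)"
  by (simp_all add: V_group_def)

text \<open>In the product the exponent of x enters the exponent of y with the factor 2, so reducing
  it modulo 2m does no harm modulo 4.\<close>

lemma mod4_eq:
  fixes a b x :: int
  shows "(a + 2 * (x mod (2 * m))) mod 4 = (a + 2 * x) mod 4"
    "(2 * (x mod (2 * m))) mod 4 = (2 * x) mod 4"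
proof -
  have "2 * (x mod (2 * m)) - 2 * x = 4 * (- (m * (x div (2 * m))))"
    by (simp add: minus_mult_div_eq_mod[symmetric] algebra_simps)
  then have "4 dvd 2 * (x mod (2 * m)) - 2 * x" by (metis dvd_triv_left)
  then show "(a + 2 * (x mod (2 * m))) mod 4 = (a + 2 * x) mod 4"
    "(2 * (x mod (2 * m))) mod 4 = (2 * x) mod 4"
    unfolding mod_eq_dvd_iff by simp_all
qed

lemma four_dvd_double_iff: "4 dvd 2 * i \<longleftrightarrow> even (i::int)"
  by presburger

lemma even_mod_4 [simp]: "even (j mod 4) \<longleftrightarrow> even (j::int)"
  by (simp add: dvd_mod_iff)

locale V_params =
  fixes m :: nat
  assumes m: "m \<ge> 2"
begin

abbreviation "V \<equiv> V_group m"
text \<open>The subgroup <x, y^2>, abelian because y^2 is central.\<close>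

abbreviation "C \<equiv> {0..<2 * int m} \<times> {j \<in> {0..<4::int}. even j}"

lemma group_V: "group V"
proof (rule groupI)
  fix x y z assume xyz: "x \<in> carrier V" "y \<in> carrier V" "z \<in> carrier V"
  show "x \<otimes>\<^bsub>V\<^esub> y \<in> carrier V"
    using xyz m by (cases x; cases y) (simp add: V_group_simps)
  obtain i1 j1 i2 j2 i3 j3 where [simp]: "x = (i1, j1)" "y = (i2, j2)" "z = (i3, j3)"
    by (cases x; cases y; cases z) auto
  show "x \<otimes>\<^bsub>V\<^esub> y \<otimes>\<^bsub>V\<^esub> z = x \<otimes>\<^bsub>V\<^esub> (y \<otimes>\<^bsub>V\<^esub> z)"
    by (cases "even j1"; cases "even j2";
      simp add: V_group_simps mod_2_eq_odd mod_simps mod_affine_eq mod4_eq;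
      simp add: algebra_simps)
next
  show "\<one>\<^bsub>V\<^esub> \<in> carrier V" using m by (simp add: V_group_simps)
next
  fix x assume x: "x \<in> carrier V"
  then show "\<one>\<^bsub>V\<^esub> \<otimes>\<^bsub>V\<^esub> x = x" by (cases x) (simp add: V_group_simps)
  obtain i j where [simp]: "x = (i, j)" by (cases x)
  show "\<exists>y\<in>carrier V. y \<otimes>\<^bsub>V\<^esub> x = \<one>\<^bsub>V\<^esub>"
  proof (cases "even j")
    case True
    then show ?thesis using m x
      by (intro bexI[of _ "((- i) mod (2 * int m), (- j) mod 4)"])
        (auto simp: V_group_simps mod_simps mod_2_eq_odd)
  next
    case False
    then show ?thesis using m x
      by (intro bexI[of _ "(i, (- j - 2 * i) mod 4)"]) (auto simp: V_group_simps mod_simps mod_affine_eq mod_2_eq_odd)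
  qed
qed

lemma center_V:
  "grp_center V = {i \<in> {0..<2 * int m}. int m dvd i \<and> even i} \<times> {j \<in> {0..<4}. even j}"
proof (intro equalityI subsetI)
  fix x assume x: "x \<in> grp_center V"
  obtain i j where [simp]: "x = (i, j)" by (cases x)
  have ij: "i \<in> {0..<2 * int m}" "j \<in> {0..<4}"
    using x by (auto simp: grp_center_def V_group_simps)
  have comm: "x \<otimes>\<^bsub>V\<^esub> g = g \<otimes>\<^bsub>V\<^esub> x" if "g \<in> carrier V" for g
    using x that by (simp add: grp_center_def)
  have "even j"
  proof (rule ccontr)
    assume "odd j"
    then have "(i - 1) mod (2 * int m) = (1 + i) mod (2 * int m)"
      using comm[of "(1, 0)"] m ij by (simp add: V_group_simps)
    then have "2 * int m dvd 2" by (simp add: mod_eq_dvd_iff)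
    then show False using m by (auto dest: zdvd_imp_le)
  qed
  moreover have "i mod (2 * int m) = - i mod (2 * int m)" "(j + 1) mod 4 = (1 + j + 2 * i) mod 4"
    using comm[of "(0, 1)"] m ij \<open>even j\<close> by (simp_all add: V_group_simps mod_2_eq_odd)
  \<comment> \<open>Commuting with y gives one condition in each coordinate: x^(2i) = 1, and a
    vanishing twist y^(2i), which forces \<open>i\<close> to be even.\<close>
  then have "2 * int m dvd 2 * i" "4 dvd 2 * i"
    unfolding mod_eq_dvd_iff by (simp_all add: dvd_diff_commute)
  then have "int m dvd i" "even i" by (simp_all add: four_dvd_double_iff)
  ultimately show "x \<in> {i \<in> {0..<2 * int m}. int m dvd i \<and> even i} \<times> {j \<in> {0..<4}. even j}"
    using ij by simp
next
  fix x assume "x \<in> {i \<in> {0..<2 * int m}. int m dvd i \<and> even i} \<times> {j \<in> {0..<4::int}. even j}"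
  then obtain i j where x: "x = (i, j)" "i \<in> {0..<2 * int m}" "int m dvd i" "even i"
    "j \<in> {0..<4}" "even j" by auto
  have "2 * int m dvd 2 * i" "4 dvd 2 * i" using x by (simp_all add: four_dvd_double_iff)
  then have "(i + a) mod (2 * int m) = (a - i) mod (2 * int m)" "(j + b) mod 4 = (b + j + 2 * i) mod 4" for a b
    unfolding mod_eq_dvd_iff by (simp_all add: algebra_simps dvd_diff_commute)
  then show "x \<in> grp_center V" using x
    by (auto simp: grp_center_def V_group_simps mod_2_eq_odd add_ac)
qed

sublocale abelian_index_two V C
proof (intro abelian_index_two.intro abelian_index_two_axioms.intro group_V)
  show "finite (carrier V)" by (simp add: V_group_simps)
  show "C \<subseteq> carrier V" by (auto simp: V_group_simps)
  show "x \<otimes>\<^bsub>V\<^esub> y \<in> C \<longleftrightarrow> (x \<in> C) = (y \<in> C)" if "x \<in> carrier V" "y \<in> carrier V" for x y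
    using that m by (cases x; cases y) (auto simp: V_group_simps)
  show "x \<otimes>\<^bsub>V\<^esub> y = y \<otimes>\<^bsub>V\<^esub> x" if "x \<in> C" "y \<in> C" for x y
    using that by (auto simp: V_group_simps add_ac mod_2_eq_odd)
  have "(1, 0) \<in> C - grp_center V" using m by (simp add: center_V)
  then show "\<not> C \<subseteq> grp_center V" by blast
qed

lemma card_even4: "card {j \<in> {0..<4::int}. even j} = 2"
  using card_multiples_int[of 2 2] by simp

text \<open>The centre has order 2 w because of the factor <y^2>, so the two outer parts have size
  \<open>w\<close> and the inner part has (4m - 2w) / 2 classes.\<close>

theorem V_tripartite:
  assumes w: "card {i \<in> {0..<2 * int m}. int m dvd i \<and> even i} = w" "w \<le> 2 * m"
  shows "nccc_integral V \<longleftrightarrow> (\<exists>k::nat. w\<^sup>2 + 8 * w * (2 * m - w) = k\<^sup>2)"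
proof (rule nccc_integral_iff_tripartite[where col = "\<lambda>g. even (fst g)" and t = "(1, 0)"])
  have dvd2: "2 dvd a - b" if "a mod (2 * int m) = b mod (2 * int m)" for a b
    using that unfolding mod_eq_dvd_iff by (meson dvd_trans dvd_triv_left)
  show "(1, 0) \<in> C" using m by simp
  show Z: "card (grp_center V) = 2 * w"
    unfolding center_V card_cartesian_product card_even4 w by simp
  show "card C = card (grp_center V) + 2 * (2 * m - w)"
    unfolding Z card_cartesian_product card_even4 using w(2) by simp
  show "even (fst ((1, 0) \<otimes>\<^bsub>V\<^esub> g)) \<noteq> even (fst g)" if "g \<in> carrier V - C" for g
    by (cases g) (simp add: V_group_simps dvd_mod_iff)
  fix g h assume gh: "g \<in> carrier V - C" "h \<in> carrier V - C"
  obtain i j i' j' where [simp]: "g = (i, j)" "h = (i', j')" by (cases g; cases h)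
  have par: "odd j" "odd j'" and h: "0 \<le> i'" "i' < 2 * int m" "0 \<le> j'" "j' < 4"
    using gh by (auto simp: V_group_simps)
  show "even (fst g) = even (fst h)" if "g \<otimes>\<^bsub>V\<^esub> h = h \<otimes>\<^bsub>V\<^esub> g"
  proof -
    \<comment> \<open>The twist in the exponent of y detects the parity of the exponent of x, so the
      outside classes split for odd \<open>m\<close> as well.\<close>
    have "(j + j' + 2 * i') mod 4 = (j' + j + 2 * i) mod 4"
      using that par by (simp add: V_group_simps mod_2_eq_odd)
    then have "4 dvd 2 * (i' - i)" unfolding mod_eq_dvd_iff by (simp add: algebra_simps)
    then have "even (i' - i)" by (simp only: four_dvd_double_iff)
    then show ?thesis by simp
  qed
  show "even (fst g) = even (fst h)" if "k \<in> carrier V" "k \<otimes>\<^bsub>V\<^esub> g = h \<otimes>\<^bsub>V\<^esub> k" for k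
    using that(2) par by (cases k) (auto simp: V_group_simps dest!: dvd2 split: if_splits)
  show "\<exists>b\<in>C. \<exists>z\<in>grp_center V. h \<otimes>\<^bsub>V\<^esub> b = z \<otimes>\<^bsub>V\<^esub> b \<otimes>\<^bsub>V\<^esub> g"
    if "even (fst g) = even (fst h)"
  proof -
    have "even (i' - i)" using that by simp
    then obtain d where d: "i' - i = 2 * d" by (elim evenE)
    then have i': "i' - d = d + i" by simp
    \<comment> \<open>Conjugation by x^d covers the shift 2 d in x; the discrepancy left in y has
      even exponent \<open>e\<close> and is therefore central.\<close>
    define e where "e = j' - j + 2 * d"
    have e: "even e" using par by (simp add: e_def)
    have "j' + 2 * d = e + j" by (simp add: e_def)
    then have 1: "(j' + 2 * d) mod 4 = (e + j) mod 4" by simp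
    show ?thesis
      by (rule bexI[of _ "(d mod (2 * int m), 0)"], rule bexI[of _ "(0, e mod 4)"])
        (use m par h 1 e i' in \<open>simp_all add: center_V V_group_simps mod_simps mod_affine_eq mod4_eq mod_2_eq_odd\<close>)
  qed
qed

end

section \<open>Integrality criteria\<close>

lemma square_mult_eq_square_iff:
  fixes n t :: nat
  assumes "n > 0"
  shows "(\<exists>k. n\<^sup>2 * t = k\<^sup>2) \<longleftrightarrow> (\<exists>k. t = k\<^sup>2)"
proof
  assume "\<exists>k. n\<^sup>2 * t = k\<^sup>2"
  then obtain k where k: "n\<^sup>2 * t = k\<^sup>2" by blast
  then have "n\<^sup>2 dvd k\<^sup>2" by (metis dvd_triv_left)
  then obtain l where "k = n * l" by auto
  then have "t = l\<^sup>2" using k assms by (simp add: power_mult_distrib)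
  then show "\<exists>k. t = k\<^sup>2" by blast
next
  assume "\<exists>k. t = k\<^sup>2"
  then show "\<exists>k. n\<^sup>2 * t = k\<^sup>2" by (metis power_mult_distrib)
qed

text \<open>Stated for \<open>- 2 * i\<close>, the simplified form of \<open>(r - 1) * i\<close> at
  \<open>r = - 1\<close>.\<close>

lemma dvd_neg_double_iff: "2 * c dvd - 2 * i \<longleftrightarrow> c dvd (i::int)"
  using dvd_times_left_cancel_iff[of 2 c i] by simp

lemma odd_dvd_neg_double_iff: "odd c \<Longrightarrow> c dvd - 2 * i \<longleftrightarrow> c dvd (i::int)"
  by (simp add: coprime_dvd_mult_right_iff)

lemma card_multiples_nat:
  assumes "a > 0"
  shows "card {i \<in> {0..<int (c * a)}. int a dvd i} = c"
  using card_multiples_int[of "int a" "int c"] assms by simp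

lemma dihedral_params: "m \<ge> 3 \<Longrightarrow> metacyclic_params (int m) (- 1) 0"
  by unfold_locales (auto dest: zdvd_imp_le)

lemma dicyclic_params: "m \<ge> 2 \<Longrightarrow> metacyclic_params (2 * int m) (- 1) (int m)"
  by unfold_locales (auto dest: zdvd_imp_le)

lemma semidihedral_params:
  assumes "m \<ge> 2"
  shows "metacyclic_params (4 * int m) (2 * int m - 1) 0"
proof
  have "(2 * int m - 1) * (2 * int m - 1) - 1 = 4 * int m * (int m - 1)"
    by (simp add: algebra_simps)
  then show "4 * int m dvd (2 * int m - 1) * (2 * int m - 1) - 1" by (metis dvd_triv_left)
  show "\<not> 4 * int m dvd 2 * int m - 1 - 1" using assms by (auto dest!: zdvd_imp_le)
qed (use assms in auto)

lemma dihedral_odd: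
  assumes "m = 2 * t + 1" "t \<ge> 1"
  shows "nccc_integral (dihedral m) \<longleftrightarrow> (\<exists>k::nat. t = k\<^sup>2)"
proof -
  interpret metacyclic_params "int m" "- 1" 0 by (rule dihedral_params) (use assms in simp)
  have z: "card {i \<in> {0..<int m}. int m dvd (- 1 - 1) * i} = 1"
    using odd_dvd_neg_double_iff[of "int m"] card_multiples_nat[of m 1] assms by simp
  \<comment> \<open>The centre is trivial, so conjugation alone must shift by 1: t + 1 is the
    inverse of 2 modulo m = 2t + 1.\<close>
  have "1 + (- 1 - 1) * (int t + 1) - 0 = - int m" using assms by simp
  then have 2: "int m dvd 1 + (- 1 - 1) * (int t + 1) - 0" by (metis dvd_minus_iff dvd_refl)
  have "nccc_integral (dihedral m) \<longleftrightarrow> (\<exists>k::nat. 1 * t = k\<^sup>2)"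
    unfolding dihedral_eq_metacyclic by (rule metacyclic_bipartite[OF _ 2 z]) (use assms in simp_all)
  then show ?thesis by simp
qed

lemma dicyclic_odd:
  assumes "m = 2 * t + 1" "t \<ge> 1"
  shows "nccc_integral (dicyclic m) \<longleftrightarrow> (\<exists>k::nat. t = k\<^sup>2)"
proof -
  interpret metacyclic_params "2 * int m" "- 1" "int m" by (rule dicyclic_params) (use assms in simp)
  have z: "card {i \<in> {0..<2 * int m}. 2 * int m dvd (- 1 - 1) * i} = 2"
    using dvd_neg_double_iff[of "int m"] card_multiples_nat[of m 2] assms by simp
  \<comment> \<open>The central element x^m has odd exponent m = 1 + 2t, which makes odd shifts
    possible.\<close>
  have 2: "2 * int m dvd 1 + (- 1 - 1) * (- int t) - int m" using assms by simp
  have 1: "2 * int m dvd (- 1 - 1) * int m" by simp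
  have "nccc_integral (dicyclic m) \<longleftrightarrow> (\<exists>k::nat. 2 * (2 * t) = k\<^sup>2)"
    unfolding dicyclic_eq_metacyclic by (rule metacyclic_bipartite[OF 1 2 z]) (use assms in simp)
  then have "nccc_integral (dicyclic m) \<longleftrightarrow> (\<exists>k::nat. 2\<^sup>2 * t = k\<^sup>2)" by simp
  then show ?thesis by (simp only: square_mult_eq_square_iff)
qed

lemma semidihedral_odd:
  assumes m: "m = 2 * t + 1" and t: "t \<ge> 1"
  shows "nccc_integral (semidihedral m) \<longleftrightarrow> (\<exists>k::nat. t = k\<^sup>2)"
proof -
  interpret metacyclic_params "4 * int m" "2 * int m - 1" 0 by (rule semidihedral_params) (use assms in simp)
  have r: "2 * int m - 1 - 1 = 4 * int t" using m by simp
  have "coprime (int m) (int t)"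
  proof (rule coprimeI)
    fix d assume "d dvd int m" "d dvd int t"
    then have "d dvd int m - 2 * int t" by simp
    then show "is_unit d" using m by simp
  qed
  then have "4 * int m dvd (2 * int m - 1 - 1) * i \<longleftrightarrow> int m dvd i" for i
    unfolding r by (simp add: mult.assoc coprime_dvd_mult_right_iff)
  then have z: "card {i \<in> {0..<4 * int m}. 4 * int m dvd (2 * int m - 1 - 1) * i} = 4"
    using card_multiples_nat[of m 4] m by simp
  have 1: "4 * int m dvd (2 * int m - 1 - 1) * (int m * int m)" unfolding r by simp
  \<comment> \<open>The identity 1 + 4 t (t + 1) = (2t + 1)^2 yields the shift; x^(m^2) is central
    because the centre consists of the powers of x^m.\<close>
  have "1 + (2 * int m - 1 - 1) * (int t + 1) - int m * int m = 0" unfolding r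
    using m by (simp add: algebra_simps)
  then have 2: "4 * int m dvd 1 + (2 * int m - 1 - 1) * (int t + 1) - int m * int m" by (simp only: dvd_0_right)
  have "nccc_integral (semidihedral m) \<longleftrightarrow> (\<exists>k::nat. 4 * (4 * t) = k\<^sup>2)"
    unfolding semidihedral_eq_metacyclic by (rule metacyclic_bipartite[OF 1 2 z]) (use m in simp)
  then have "nccc_integral (semidihedral m) \<longleftrightarrow> (\<exists>k::nat. 4\<^sup>2 * t = k\<^sup>2)" by simp
  then show ?thesis by (simp only: square_mult_eq_square_iff)
qed

lemma U_group_odd:
  assumes m: "m = 2 * t + 1" and t: "t \<ge> 1" and n: "n > 0"
  shows "nccc_integral (U_group n m) \<longleftrightarrow> (\<exists>k::nat. t = k\<^sup>2)"
proof -
  interpret U: U_params n m using assms by unfold_locales auto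
  have "nccc_integral (U_group n m) \<longleftrightarrow> (\<exists>k::nat. n\<^sup>2 * t = k\<^sup>2)"
    using U.U_bipartite[of 1 m] m by simp
  then show ?thesis by (simp only: square_mult_eq_square_iff[OF n])
qed

lemma dihedral_twice_odd:
  assumes m: "m = 2 * r" and r: "odd r" "r \<ge> 3"
  shows "nccc_integral (dihedral m) \<longleftrightarrow> (\<exists>k::nat. m - 2 = k\<^sup>2)"
proof -
  interpret metacyclic_params "int m" "- 1" 0 by (rule dihedral_params) (use m r in simp)
  have z: "card {i \<in> {0..<int m}. int m dvd (- 1 - 1) * i} = 2"
    using dvd_neg_double_iff[of "int r"] card_multiples_nat[of r 2] m r by simp
  \<comment> \<open>Now x^r with r = m / 2 is central, and its odd exponent supplies the shift 1 up
    to an even number.\<close>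
  have "1 - int r = 2 * ((1 - int r) div 2)" using r(1) by simp
  then have 2: "int m dvd 1 + (- 1 - 1) * ((1 - int r) div 2) - int r" by simp
  have "nccc_integral (dihedral m) \<longleftrightarrow> (\<exists>k::nat. 2 * (r - 1) = k\<^sup>2)"
    unfolding dihedral_eq_metacyclic
    by (rule metacyclic_bipartite[OF _ 2 z]) (use m r in auto)
  moreover have "2 * (r - 1) = m - 2" using m by simp
  ultimately show ?thesis by simp
qed

lemma U_group_twice_odd:
  assumes m: "m = 2 * r" and r: "odd r" "r \<ge> 3" and n: "n > 0"
  shows "nccc_integral (U_group n m) \<longleftrightarrow> (\<exists>k::nat. m - 2 = k\<^sup>2)"
proof -
  interpret U: U_params n m using assms by unfold_locales auto
  have "2\<^sup>2 * ((r - 1) div 2) = m - 2" using m r(1) by (auto elim: oddE)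
  then have "nccc_integral (U_group n m) \<longleftrightarrow> (\<exists>k::nat. n\<^sup>2 * (m - 2) = k\<^sup>2)"
    using U.U_bipartite[of 2 r] m r by simp
  then show ?thesis by (simp only: square_mult_eq_square_iff[OF n])
qed

lemma dihedral_four_dvd:
  assumes m: "m = 4 * u" and u: "u \<ge> 1"
  shows "nccc_integral (dihedral m) \<longleftrightarrow> (\<exists>k::nat. 4 * m - 7 = k\<^sup>2)"
proof -
  interpret metacyclic_params "int m" "- 1" 0 by (rule dihedral_params) (use m u in simp)
  have dvd: "int m dvd (- 1 - 1) * i \<longleftrightarrow> 2 * int u dvd i" for i
    using dvd_neg_double_iff[of "2 * int u" i] m by simp
  have z: "card {i \<in> {0..<int m}. int m dvd (- 1 - 1) * i} = 2 * 1"
    unfolding dvd using card_multiples_nat[of "2 * u" 2] m u by simp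
  have "nccc_integral (dihedral m) \<longleftrightarrow> (\<exists>k::nat. 1\<^sup>2 + 8 * 1 * (2 * u - 1) = k\<^sup>2)"
    unfolding dihedral_eq_metacyclic
  proof (rule metacyclic_tripartite[OF _ _ _ _ z])
    show "even d" if "int m dvd (- 1 - 1) * d" for d using that unfolding dvd by auto
    \<comment> \<open>Conjugation by x alone shifts by 2. The central exponents are multiples of 2u,
      hence even, so no odd shift occurs.\<close>
    show "int m dvd (- 1 - 1) * 0" "int m dvd 2 + (- 1 - 1) * 1 - 0" by simp_all
  qed (use m u in auto)
  moreover have "1\<^sup>2 + 8 * 1 * (2 * u - 1) = 4 * m - 7" using m u by simp
  ultimately show ?thesis by simp
qed

lemma dicyclic_even:
  assumes m: "even m" "m \<ge> 2"
  shows "nccc_integral (dicyclic m) \<longleftrightarrow> (\<exists>k::nat. 8 * m - 7 = k\<^sup>2)"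
proof -
  interpret metacyclic_params "2 * int m" "- 1" "int m" by (rule dicyclic_params) (use m in simp)
  have dvd: "2 * int m dvd (- 1 - 1) * i \<longleftrightarrow> int m dvd i" for i
    using dvd_neg_double_iff[of "int m" i] by simp
  have z: "card {i \<in> {0..<2 * int m}. 2 * int m dvd (- 1 - 1) * i} = 2 * 1"
    unfolding dvd using card_multiples_nat[of m 2] m by simp
  have "nccc_integral (dicyclic m) \<longleftrightarrow> (\<exists>k::nat. 1\<^sup>2 + 8 * 1 * (m - 1) = k\<^sup>2)"
    unfolding dicyclic_eq_metacyclic
  proof (rule metacyclic_tripartite[OF _ _ _ _ z])
    have "even (int m)" using m by simp
    then show "even d" if "2 * int m dvd (- 1 - 1) * d" for d
      using that dvd_trans unfolding dvd by blast
    show "2 * int m dvd (- 1 - 1) * 0" "2 * int m dvd 2 + (- 1 - 1) * 1 - 0" by simp_all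
  qed (use m in auto)
  moreover have "1\<^sup>2 + 8 * 1 * (m - 1) = 8 * m - 7" using m by simp
  ultimately show ?thesis by simp
qed

lemma semidihedral_even:
  assumes m: "even m" "m \<ge> 2"
  shows "nccc_integral (semidihedral m) \<longleftrightarrow> (\<exists>k::nat. 16 * m - 7 = k\<^sup>2)"
proof -
  interpret metacyclic_params "4 * int m" "2 * int m - 1" 0 by (rule semidihedral_params) (use m in simp)
  \<comment> \<open>Since r - 1 = 2 (m - 1), coprimality of m - 1 with 2m reduces the centre to the
    powers of x^(2m).\<close>
  have "coprime (int m) (int m - 1)" by simp
  moreover have "coprime 2 (int m - 1)" using m(1) by simp
  ultimately have "coprime (2 * int m) (int m - 1)" by simp
  moreover have "4 * int m dvd (2 * int m - 1 - 1) * i \<longleftrightarrow> 2 * int m dvd (int m - 1) * i" for i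
    using dvd_times_left_cancel_iff[of 2 "2 * int m" "(int m - 1) * i"] by (simp add: algebra_simps)
  ultimately have dvd: "4 * int m dvd (2 * int m - 1 - 1) * i \<longleftrightarrow> 2 * int m dvd i" for i
    by (simp add: coprime_dvd_mult_right_iff)
  have z: "card {i \<in> {0..<4 * int m}. 4 * int m dvd (2 * int m - 1 - 1) * i} = 2 * 1"
    unfolding dvd using card_multiples_nat[of "2 * m" 2] m by simp
  have "nccc_integral (semidihedral m) \<longleftrightarrow> (\<exists>k::nat. 1\<^sup>2 + 8 * 1 * (2 * m - 1) = k\<^sup>2)"
    unfolding semidihedral_eq_metacyclic
  proof (rule metacyclic_tripartite[OF _ _ _ _ z])
    show "even d" if "4 * int m dvd (2 * int m - 1 - 1) * d" for d
      using that unfolding dvd by auto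
    show "4 * int m dvd (2 * int m - 1 - 1) * (2 * int m)" unfolding dvd by simp
    show "4 * int m dvd 2 + (2 * int m - 1 - 1) * 1 - 2 * int m" by simp
  qed (use m in auto)
  moreover have "1\<^sup>2 + 8 * 1 * (2 * m - 1) = 16 * m - 7" using m by simp
  ultimately show ?thesis by simp
qed

text \<open>For even \<open>m\<close> both 1 and x^m survive in the x-part of the centre, so
  \<open>w = 2\<close> and the discriminant carries an extra factor 4.\<close>

lemma V_group_even:
  assumes m: "even m" "m \<ge> 2"
  shows "nccc_integral (V_group m) \<longleftrightarrow> (\<exists>k::nat. 8 * m - 7 = k\<^sup>2)"
proof -
  interpret V: V_params m using m by unfold_locales
  have "even (int m)" using m by simp
  then have "int m dvd i \<and> even i \<longleftrightarrow> int m dvd i" for i using dvd_trans by blast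
  then have w: "card {i \<in> {0..<2 * int m}. int m dvd i \<and> even i} = 2"
    using card_multiples_nat[of m 2] m by simp
  have "2\<^sup>2 + 8 * 2 * (2 * m - 2) = 2\<^sup>2 * (8 * m - 7)" using m by simp
  then have "nccc_integral (V_group m) \<longleftrightarrow> (\<exists>k::nat. 2\<^sup>2 * (8 * m - 7) = k\<^sup>2)"
    using V.V_tripartite[OF w] m by simp
  then show ?thesis by (simp only: square_mult_eq_square_iff)
qed

lemma V_group_odd:
  assumes m: "odd m" "m \<ge> 3"
  shows "nccc_integral (V_group m) \<longleftrightarrow> (\<exists>k::nat. 16 * m - 7 = k\<^sup>2)"
proof -
  interpret V: V_params m using m by unfold_locales simp
  have "coprime 2 (int m)" using m by simp
  then have "int m dvd i \<and> even i \<longleftrightarrow> 2 * int m dvd i" for i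
    by (metis divides_mult dvd_mult_left dvd_mult_right)
  then have w: "card {i \<in> {0..<2 * int m}. int m dvd i \<and> even i} = 1"
    using card_multiples_nat[of "2 * m" 1] m by simp
  have "1\<^sup>2 + 8 * 1 * (2 * m - 1) = 16 * m - 7" using m by simp
  then show ?thesis using V.V_tripartite[OF w] m by simp
qed

lemma ex_twice_square_plus_one_iff:
  assumes "m = 2 * t + 1" "t \<ge> 1"
  shows "(\<exists>a::nat. a \<ge> 1 \<and> m = 2 * a\<^sup>2 + 1) \<longleftrightarrow> (\<exists>k::nat. t = k\<^sup>2)"
proof -
  have "a \<ge> 1" if "t = a\<^sup>2" for a :: nat using that assms by (cases a) auto
  then show ?thesis using assms by auto
qed

text \<open>The bound on \<open>m\<close> gives a square of at least 4, which excludes the roots 0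
  and 1.\<close>

lemma ex_square_plus_two_iff:
  assumes "m \<ge> 6"
  shows "(\<exists>a::nat. a \<ge> 2 \<and> m = a\<^sup>2 + 2) \<longleftrightarrow> (\<exists>k::nat. m - 2 = k\<^sup>2)"
proof -
  have "a \<ge> 2" if "m - 2 = a\<^sup>2" for a :: nat
  proof (rule ccontr)
    assume "\<not> a \<ge> 2"
    then have "a = 0 \<or> a = 1" by auto
    then show False using that assms by auto
  qed
  moreover have "m = a\<^sup>2 + 2 \<longleftrightarrow> m - 2 = a\<^sup>2" for a :: nat using assms by auto
  ultimately show ?thesis by auto
qed

theorem theorem3p1:
  shows
  \<comment> \<open>(1)\<close>
  "(\<forall>m::nat. m \<ge> 3 \<and> odd m \<longrightarrow>
      (let P = (\<exists>a::nat. a \<ge> 1 \<and> m = 2 * a ^ 2 + 1) in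
        (nccc_integral (dihedral m) \<longleftrightarrow> P) \<and>
        (nccc_integral (dicyclic m) \<longleftrightarrow> P) \<and>
        (\<forall>n::nat. n \<ge> 2 \<longrightarrow> (nccc_integral (U_group n m) \<longleftrightarrow> P)) \<and>
        (nccc_integral (semidihedral m) \<longleftrightarrow> P)))
   \<and>
  \<comment> \<open>(2)\<close>
   (\<forall>m::nat. m \<ge> 6 \<and> even m \<and> odd (m div 2) \<longrightarrow>
      (let P = (\<exists>a::nat. a \<ge> 2 \<and> m = a ^ 2 + 2) in
        (nccc_integral (dihedral m) \<longleftrightarrow> P) \<and>
        (\<forall>n::nat. n \<ge> 2 \<longrightarrow> (nccc_integral (U_group n m) \<longleftrightarrow> P))))
   \<and>
  \<comment> \<open>(3)\<close>
   (\<forall>m::nat. m \<ge> 4 \<and> even m \<and> even (m div 2) \<longrightarrow>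
      (nccc_integral (dihedral m) \<longleftrightarrow> (\<exists>k::nat. 4 * m - 7 = k ^ 2)))
   \<and>
  \<comment> \<open>(4)\<close>
   (\<forall>m::nat. m \<ge> 2 \<and> even m \<longrightarrow>
      (nccc_integral (dicyclic m) \<longleftrightarrow> (\<exists>k::nat. 8 * m - 7 = k ^ 2)) \<and>
      (nccc_integral (semidihedral m) \<longleftrightarrow> (\<exists>k::nat. 16 * m - 7 = k ^ 2)))
   \<and>
  \<comment> \<open>(5)\<close>
   (\<forall>m::nat. m \<ge> 2 \<and> even m \<longrightarrow>
      (nccc_integral (V_group m) \<longleftrightarrow> (\<exists>k::nat. 8 * m - 7 = k ^ 2)))
   \<and>
   (\<forall>m::nat. m \<ge> 3 \<and> odd m \<longrightarrow>
      (nccc_integral (V_group m) \<longleftrightarrow> (\<exists>k::nat. 16 * m - 7 = k ^ 2)))"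
proof (intro conjI allI impI)
  fix m :: nat assume "m \<ge> 3 \<and> odd m"
  then obtain t where t: "m = 2 * t + 1" "t \<ge> 1" by (auto elim!: oddE)
  show "let P = (\<exists>a::nat. a \<ge> 1 \<and> m = 2 * a ^ 2 + 1) in
        (nccc_integral (dihedral m) \<longleftrightarrow> P) \<and>
        (nccc_integral (dicyclic m) \<longleftrightarrow> P) \<and>
        (\<forall>n::nat. n \<ge> 2 \<longrightarrow> (nccc_integral (U_group n m) \<longleftrightarrow> P)) \<and>
        (nccc_integral (semidihedral m) \<longleftrightarrow> P)"
    unfolding Let_def ex_twice_square_plus_one_iff[OF t]
    using dihedral_odd[OF t] dicyclic_odd[OF t] semidihedral_odd[OF t] U_group_odd[OF t] by simp
next
  fix m :: nat assume m: "m \<ge> 6 \<and> even m \<and> odd (m div 2)"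
  then have r: "m = 2 * (m div 2)" "odd (m div 2)" "m div 2 \<ge> 3" and m6: "m \<ge> 6" by auto
  show "let P = (\<exists>a::nat. a \<ge> 2 \<and> m = a ^ 2 + 2) in
        (nccc_integral (dihedral m) \<longleftrightarrow> P) \<and>
        (\<forall>n::nat. n \<ge> 2 \<longrightarrow> (nccc_integral (U_group n m) \<longleftrightarrow> P))"
    unfolding Let_def ex_square_plus_two_iff[OF m6]
    using dihedral_twice_odd[OF r] U_group_twice_odd[OF r] by simp
next
  fix m :: nat assume m: "m \<ge> 4 \<and> even m \<and> even (m div 2)"
  then obtain u where "m = 4 * u" "u \<ge> 1" by (auto elim!: evenE)
  then show "nccc_integral (dihedral m) \<longleftrightarrow> (\<exists>k::nat. 4 * m - 7 = k ^ 2)"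
    by (rule dihedral_four_dvd)
qed (simp_all add: dicyclic_even semidihedral_even V_group_even V_group_odd)

end
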